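(* Let $f$ and $g$ be (monotone) functions on the finite simplicial complex $\mathcal{K}$, and let $\mathcal{V}$ be the vineyard in dimension $d$ induced by the straight-line homotopy between $f$ and $g$, i.e. $\mathcal{V}(t)=\mathsf{dgm}_d((1-t)f+tg)$ for $t\in[0,1]$. Then the unweighted vineyard distance satisfies $$\mathbb{V}(\mathcal{V})\le\sum_{\sigma\in\mathcal{K},\ \dim(\sigma)\in\{d,d+1\}}|f(\sigma)-g(\sigma)|.$$
   Context: A function $f:\mathcal{K}\to\mathbb{R}$ on a finite simplicial complex $\mathcal{K}$ always means a real-valued function on the simplices of $\mathcal{K}$ that is monotone: $f(\sigma)\le f(\tau)$ whenever $\sigma$ is a face of $\tau$. Its sublevel sets $\mathcal{K}_t=\{\sigma: f(\sigma)\le t\}$ form a filtration, and $\mathsf{dgm}_d(f)$ is the persistence diagram of the $d$-dimensional simplicial persistent homology (coefficients in a fixed field) of this filtration: the multiset of birth/death pairs $(b,d)$. Diagrams are finite multisets of points in $\mathbb{R}^2_{x\le y}=\{(x,y)\in\mathbb{R}^2:x\le y\}$; features that never die are either omitted or assigned as death value a fixed constant ceiling $C$ (the same for all $t$, at least as large as all values of $f$ and $g$). Points on the diagonal $\Delta=\{(x,x)\}$ are allowed but regarded as negligible. Let $\mathcal{D}$ be the set of all persistence diagrams with the topology arising from the bottleneck distance $$W_\infty(P,Q)=\min_{\pi:A\to B}\max\Big(\max_{\alpha\in A}d_\infty(\alpha,\pi(\alpha)),\max_{\alpha\in P\setminus A}d_\infty(\alpha,\Delta),\max_{\beta\in Q\setminus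 B}d_\infty(\beta,\Delta)\Big),$$ where $\pi$ ranges over bijections between sub-multisets $A\subseteq P$ and $B\subseteq Q$ and $d_\infty$ is the sup-norm metric. A vineyard is a continuous map $\mathcal{V}:[0,1]\to\mathcal{D}$. Standing assumption: every vineyard considered can be decomposed into finitely many rectifiable (continuous) curves $V_i:[0,1]\to\mathbb{R}^2$, $1\le i\le m$, called vines, such that for every $t$, $\mathcal{V}(t)$ is the multiset $\{V_i(t):1\le i\le m\}$ (up to the negligible points on $\Delta$), and each vine $V$ is of one of four types: (1) $V$ never meets $\Delta$; (2) $\mathrm{Im}(V)\cap\Delta=\{x\}$ and $V^{-1}(x)$ is a closed interval containing $1$; (3) $\mathrm{Im}(V)\cap\Delta=\{x\}$ and $V^{-1}(x)$ is a closed interval containing $0$; (4) $\mathrm{Im}(V)\cap\Delta=\{x,y\}$ and $V^{-1}(x)\cup V^{-1}(y)$ is a union of two closed intervals which contains $0$ and $1$. The unweighted vineyard distance is $\mathbb{V}(\mathcal{V})=\sum_{i=1}^m\int_{V_i}ds$, the sum of the lengths of the vines in any such decomposition, with length measured in the $\ell^\infty$ metric on the plane. *)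

theory Defs
  imports "HOL-Analysis.Analysis" "HOL-Library.Multiset" "HOL-Library.Function_Algebras"
begin

section \<open>Simplicial homology over a field\<close>

definition simplicial_complex :: "'v set set \<Rightarrow> bool" where
  "simplicial_complex K \<longleftrightarrow>
     finite K \<and> (\<forall>\<sigma>\<in>K. finite \<sigma> \<and> \<sigma> \<noteq> {} \<and> (\<forall>\<tau>. \<tau> \<subseteq> \<sigma> \<and> \<tau> \<noteq> {} \<longrightarrow> \<tau> \<in> K))"

definition simplex_dim :: "'v set \<Rightarrow> nat" where
  "simplex_dim \<sigma> = card \<sigma> - 1"

text \<open>
  Simplices are oriented by the order of the vertex type, so a chain is a function assigning
  a coefficient to every simplex.  The choice of the order does not affect homology up to
  isomorphism, and the vertices of a finite complex can always be ordered.
\<close>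

definition chain_scale :: "'k::field \<Rightarrow> ('v set \<Rightarrow> 'k) \<Rightarrow> 'v set \<Rightarrow> 'k" where
  "chain_scale a c = (\<lambda>\<sigma>. a * c \<sigma>)"

interpretation chain: vector_space chain_scale
  by unfold_locales (auto simp: chain_scale_def algebra_simps)

definition chains :: "nat \<Rightarrow> 'v set set \<Rightarrow> ('v set \<Rightarrow> 'k::field) set" where
  "chains p L = {c. \<forall>\<sigma>. c \<sigma> \<noteq> 0 \<longrightarrow> \<sigma> \<in> L \<and> simplex_dim \<sigma> = p}"

text \<open>
  For \<open>\<sigma> = {v\<^sub>0 < \<dots> < v\<^sub>p}\<close> the coefficient of \<open>\<sigma> - {v\<^sub>i}\<close> in the boundary of \<open>\<sigma>\<close> is \<open>(-1)^i\<close>;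
  the sum below has at most one term.
\<close>

definition incidence :: "'v::linorder set \<Rightarrow> 'v set \<Rightarrow> 'k::field" where
  "incidence \<sigma> \<tau> = (\<Sum>v | v \<in> \<sigma> \<and> \<tau> = \<sigma> - {v}. (-1) ^ card {u \<in> \<sigma>. u < v})"

text \<open>Homology is not reduced: the empty set is not a simplex, so vertices have boundary 0.\<close>

definition boundary :: "'v::linorder set set \<Rightarrow> ('v set \<Rightarrow> 'k::field) \<Rightarrow> 'v set \<Rightarrow> 'k" where
  "boundary L c = (\<lambda>\<tau>. if \<tau> = {} then 0 else \<Sum>\<sigma>\<in>L. c \<sigma> * incidence \<sigma> \<tau>)"

definition cycles :: "nat \<Rightarrow> 'v::linorder set set \<Rightarrow> ('v set \<Rightarrow> 'k::field) set" where
  "cycles p L = {c \<in> chains p L. boundary L c = 0}"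

definition boundaries :: "nat \<Rightarrow> 'v::linorder set set \<Rightarrow> ('v set \<Rightarrow> 'k::field) set" where
  "boundaries p L = boundary L ` chains (Suc p) L"

section \<open>Persistence diagrams\<close>

text \<open>
  For subcomplexes \<open>L \<subseteq> M\<close>, the persistent Betti number is the rank of the map
  \<open>H\<^sub>p(L) \<rightarrow> H\<^sub>p(M)\<close> induced by inclusion.  Its image is the persistent homology group
  \<open>Z\<^sub>p(L) / (Z\<^sub>p(L) \<inter> B\<^sub>p(M))\<close>.
\<close>

definition persistent_betti ::
    "'k::field itself \<Rightarrow> nat \<Rightarrow> 'v::linorder set set \<Rightarrow> 'v set set \<Rightarrow> nat" where
  "persistent_betti _ p L M =
     chain.dim (cycles p L :: ('v set \<Rightarrow> 'k) set)
     - chain.dim (cycles p L \<inter> boundaries p M :: ('v set \<Rightarrow> 'k) set)"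

definition sublevel :: "'v set set \<Rightarrow> ('v set \<Rightarrow> real) \<Rightarrow> real \<Rightarrow> 'v set set" where
  "sublevel K f t = {\<sigma> \<in> K. f \<sigma> \<le> t}"

text \<open>
  The strict sublevel set at a value of \<open>f\<close> is the sublevel set at the preceding value
  (or empty).
\<close>

definition strict_sublevel :: "'v set set \<Rightarrow> ('v set \<Rightarrow> real) \<Rightarrow> real \<Rightarrow> 'v set set" where
  "strict_sublevel K f t = {\<sigma> \<in> K. f \<sigma> < t}"

text \<open>
  The number of classes born at \<open>a\<close> and dying at \<open>b\<close>, for \<open>a < b\<close>: those born at \<open>a\<close> that are
  still alive just before \<open>b\<close>, minus those born at \<open>a\<close> that are still alive at \<open>b\<close>.
\<close>

definition pair_multiplicity ::
    "'k::field itself \<Rightarrow> nat \<Rightarrow> 'v::linorder set set \<Rightarrow> ('v set \<Rightarrow> real) \<Rightarrow> real \<Rightarrow> real \<Rightarrow> nat" where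
  "pair_multiplicity k p K f a b =
     nat ((int (persistent_betti k p (sublevel K f a) (strict_sublevel K f b))
           - int (persistent_betti k p (strict_sublevel K f a) (strict_sublevel K f b)))
        - (int (persistent_betti k p (sublevel K f a) (sublevel K f b))
           - int (persistent_betti k p (strict_sublevel K f a) (sublevel K f b))))"

definition essential_multiplicity ::
    "'k::field itself \<Rightarrow> nat \<Rightarrow> 'v::linorder set set \<Rightarrow> ('v set \<Rightarrow> real) \<Rightarrow> real \<Rightarrow> nat" where
  "essential_multiplicity k p K f a =
     persistent_betti k p (sublevel K f a) K - persistent_betti k p (strict_sublevel K f a) K"

text \<open>
  Classes that never die are omitted if \<open>ceil\<close> is \<open>None\<close>, and die at \<open>C\<close> if it is
  \<open>Some C\<close>.
\<close>

definition dgm ::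
    "'k::field itself \<Rightarrow> real option \<Rightarrow> nat \<Rightarrow> 'v::linorder set set \<Rightarrow> ('v set \<Rightarrow> real)
      \<Rightarrow> (real \<times> real) multiset" where
  "dgm k ceil p K f =
     (\<Sum>(a, b) \<in> {(a, b). a \<in> f ` K \<and> b \<in> f ` K \<and> a < b}.
        replicate_mset (pair_multiplicity k p K f a b) (a, b))
     + (case ceil of
          None \<Rightarrow> {#}
        | Some C \<Rightarrow> (\<Sum>a \<in> f ` K. replicate_mset (essential_multiplicity k p K f a) (a, C)))"

section \<open>Bottleneck distance\<close>

definition diagonal :: "(real \<times> real) set" where
  "diagonal = {(x, x) | x. True}"

definition d_inf :: "real \<times> real \<Rightarrow> real \<times> real \<Rightarrow> real" where
  "d_inf p q = max \<bar>fst p - fst q\<bar> \<bar>snd p - snd q\<bar>"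

definition d_inf_diagonal :: "real \<times> real \<Rightarrow> real" where
  "d_inf_diagonal p = (INF q\<in>diagonal. d_inf p q)"

text \<open>
  A bijection between sub-multisets of \<open>P\<close> and \<open>Q\<close> is given by its graph, a multiset of pairs.
\<close>

definition matchings ::
    "(real \<times> real) multiset \<Rightarrow> (real \<times> real) multiset
      \<Rightarrow> ((real \<times> real) \<times> (real \<times> real)) multiset set" where
  "matchings P Q = {M. image_mset fst M \<subseteq># P \<and> image_mset snd M \<subseteq># Q}"

text \<open>The inserted 0 only matters when both diagrams are empty.\<close>

definition matching_cost ::
    "(real \<times> real) multiset \<Rightarrow> (real \<times> real) multiset
      \<Rightarrow> ((real \<times> real) \<times> (real \<times> real)) multiset \<Rightarrow> real" where
  "matching_cost P Q M =
     Max (insert 0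
       ((\<lambda>(p, q). d_inf p q) ` set_mset M
        \<union> d_inf_diagonal ` set_mset (P - image_mset fst M)
        \<union> d_inf_diagonal ` set_mset (Q - image_mset snd M)))"

text \<open>There are only finitely many matchings, so the infimum is a minimum.\<close>

definition bottleneck :: "(real \<times> real) multiset \<Rightarrow> (real \<times> real) multiset \<Rightarrow> real" where
  "bottleneck P Q = (INF M\<in>matchings P Q. matching_cost P Q M)"

section \<open>Vineyards\<close>

definition persistence_diagram :: "(real \<times> real) multiset \<Rightarrow> bool" where
  "persistence_diagram P \<longleftrightarrow> (\<forall>p\<in>#P. fst p \<le> snd p)"

definition vineyard :: "(real \<Rightarrow> (real \<times> real) multiset) \<Rightarrow> bool" where
  "vineyard \<V> \<longleftrightarrow>
     (\<forall>t\<in>{0..1}. persistence_diagram (\<V> t)) \<and>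
     (\<forall>s\<in>{0..1}. \<forall>\<epsilon>>0. \<exists>\<delta>>0. \<forall>t\<in>{0..1}. \<bar>t - s\<bar> < \<delta> \<longrightarrow> bottleneck (\<V> s) (\<V> t) < \<epsilon>)"

text \<open>The length of a curve with respect to the sup-norm metric.\<close>

definition curve_length :: "(real \<Rightarrow> real \<times> real) \<Rightarrow> ennreal" where
  "curve_length \<gamma> =
     (SUP ts\<in>{ts. sorted ts \<and> set ts \<subseteq> {0..1}}.
        ennreal (\<Sum>i<length ts - 1. d_inf (\<gamma> (ts ! i)) (\<gamma> (ts ! Suc i))))"

definition vine_type1 :: "(real \<Rightarrow> real \<times> real) \<Rightarrow> bool" where
  "vine_type1 V \<longleftrightarrow> V ` {0..1} \<inter> diagonal = {}"

definition vine_type2 :: "(real \<Rightarrow> real \<times> real) \<Rightarrow> bool" where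
  "vine_type2 V \<longleftrightarrow>
     (\<exists>x. V ` {0..1} \<inter> diagonal = {x} \<and> (\<exists>a\<in>{0..1}. {t \<in> {0..1}. V t = x} = {a..1}))"

definition vine_type3 :: "(real \<Rightarrow> real \<times> real) \<Rightarrow> bool" where
  "vine_type3 V \<longleftrightarrow>
     (\<exists>x. V ` {0..1} \<inter> diagonal = {x} \<and> (\<exists>a\<in>{0..1}. {t \<in> {0..1}. V t = x} = {0..a}))"

definition vine_type4 :: "(real \<Rightarrow> real \<times> real) \<Rightarrow> bool" where
  "vine_type4 V \<longleftrightarrow>
     (\<exists>x y. V ` {0..1} \<inter> diagonal = {x, y} \<and>
        (\<exists>a\<in>{0..1}. \<exists>b\<in>{0..1}.
           {t \<in> {0..1}. V t = x} \<union> {t \<in> {0..1}. V t = y} = {0..a} \<union> {b..1}))"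

definition vine :: "(real \<Rightarrow> real \<times> real) \<Rightarrow> bool" where
  "vine V \<longleftrightarrow> continuous_on {0..1} V \<and> curve_length V < \<infinity> \<and>
     (vine_type1 V \<or> vine_type2 V \<or> vine_type3 V \<or> vine_type4 V)"

definition off_diagonal :: "(real \<times> real) multiset \<Rightarrow> (real \<times> real) multiset" where
  "off_diagonal P = filter_mset (\<lambda>p. p \<notin> diagonal) P"

definition vine_decomposition ::
    "(real \<Rightarrow> (real \<times> real) multiset) \<Rightarrow> (real \<Rightarrow> real \<times> real) list \<Rightarrow> bool" where
  "vine_decomposition \<V> Vs \<longleftrightarrow>
     (\<forall>V\<in>set Vs. vine V) \<and>
     (\<forall>t\<in>{0..1}. off_diagonal (mset (map (\<lambda>V. V t) Vs)) = off_diagonal (\<V> t))"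

definition decomposable_vineyard :: "(real \<Rightarrow> (real \<times> real) multiset) \<Rightarrow> bool" where
  "decomposable_vineyard \<V> \<longleftrightarrow> vineyard \<V> \<and> (\<exists>Vs. vine_decomposition \<V> Vs)"

text \<open>
  The total length of the vines does not depend on the decomposition.  The supremum is this
  common value, and an upper bound for it is an upper bound for every decomposition.  It is
  meaningful for decomposable vineyards only.
\<close>

definition vineyard_distance :: "(real \<Rightarrow> (real \<times> real) multiset) \<Rightarrow> ennreal" where
  "vineyard_distance \<V> =
     (SUP Vs\<in>{Vs. vine_decomposition \<V> Vs}. \<Sum>V\<leftarrow>Vs. curve_length V)"

definition straight_line_vineyard ::
    "'k::field itself \<Rightarrow> real option \<Rightarrow> nat \<Rightarrow> 'v::linorder set set
      \<Rightarrow> ('v set \<Rightarrow> real) \<Rightarrow> ('v set \<Rightarrow> real) \<Rightarrow> real \<Rightarrow> (real \<times> real) multiset" where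
  "straight_line_vineyard k ceil d K f g t =
     dgm k ceil d K (\<lambda>\<sigma>. (1 - t) * f \<sigma> + t * g \<sigma>)"

section \<open>Continuity follows from the existence of a vine decomposition\<close>

lemma d_inf_diagonal_le: "q \<in> diagonal \<Longrightarrow> d_inf_diagonal p \<le> d_inf p q"
  unfolding d_inf_diagonal_def
  by (rule cINF_lower) (auto intro!: bdd_belowI2[where m = 0] simp: d_inf_def)

lemma d_inf_commute: "d_inf p q = d_inf q p"
  by (simp add: d_inf_def abs_minus_commute)

lemma d_inf_le_dist: "d_inf p q \<le> dist p q"
  using dist_fst_le[of p q] dist_snd_le[of p q] by (simp add: d_inf_def dist_real_def)

lemma unmatched_le:
  assumes P: "off_diagonal P = off_diagonal (mset (map h Vs))"
    and p: "p \<in># P - mset (map h (filter (\<lambda>V. h V \<notin> diagonal \<and> k V \<notin> diagonal) Vs))"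
  shows "p \<in> diagonal \<or> (\<exists>V\<in>set Vs. p = h V \<and> k V \<in> diagonal)"
proof (cases "p \<in> diagonal")
  case False
  let ?A = "filter (\<lambda>V. h V \<notin> diagonal \<and> k V \<notin> diagonal) Vs"
  let ?B = "filter (\<lambda>V. h V \<notin> diagonal \<and> k V \<in> diagonal) Vs"
  have "off_diagonal (mset (map h Vs)) = mset (map h ?A) + mset (map h ?B)"
    by (induction Vs) (auto simp: off_diagonal_def)
  moreover have "count P p = count (off_diagonal P) p"
    using False by (simp add: off_diagonal_def)
  ultimately have "count (P - mset (map h ?A)) p = count (mset (map h ?B)) p"
    using P by simp
  then have "p \<in># mset (map h ?B)"
    using p by (metis count_eq_zero_iff)
  then show ?thesis by auto
qed simp

lemma vineyard_if_vine_decomposition: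
  assumes dec: "vine_decomposition \<V> Vs"
    and dia: "\<And>t. t \<in> {0..1} \<Longrightarrow> persistence_diagram (\<V> t)"
  shows "vineyard \<V>"
  unfolding vineyard_def
proof (intro conjI ballI allI impI)
  fix s \<epsilon> :: real
  assume s: "s \<in> {0..1}" and \<epsilon>: "\<epsilon> > 0"
  have "\<forall>V\<in>set Vs. \<exists>\<delta>>0. \<forall>t\<in>{0..1}. dist t s < \<delta> \<longrightarrow> dist (V t) (V s) < \<epsilon>"
    using dec s \<epsilon> unfolding vine_decomposition_def vine_def continuous_on_iff by blast
  then obtain D where D: "\<And>V. V \<in> set Vs \<Longrightarrow> D V > 0 \<and>
      (\<forall>t\<in>{0..1}. dist t s < D V \<longrightarrow> dist (V t) (V s) < \<epsilon>)"
    by metis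
  define \<delta> where "\<delta> = Min (insert 1 (D ` set Vs))"
  show "\<exists>\<delta>>0. \<forall>t\<in>{0..1}. \<bar>t - s\<bar> < \<delta> \<longrightarrow> bottleneck (\<V> s) (\<V> t) < \<epsilon>"
  proof (intro exI[of _ \<delta>] conjI ballI impI)
    show "\<delta> > 0" unfolding \<delta>_def using D by (subst Min_gr_iff) auto
    fix t :: real
    assume t: "t \<in> {0..1}" and ts: "\<bar>t - s\<bar> < \<delta>"
    have close: "d_inf (V s) (V t) < \<epsilon>" if V: "V \<in> set Vs" for V
    proof -
      have "\<delta> \<le> D V" unfolding \<delta>_def using V by (intro Min_le) auto
      then have "dist (V t) (V s) < \<epsilon>" using D[OF V] t ts by (auto simp: dist_real_def)
      then show ?thesis using d_inf_le_dist[of "V s" "V t"] by (simp add: dist_commute)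
    qed
    define F where "F = filter (\<lambda>V. V s \<notin> diagonal \<and> V t \<notin> diagonal) Vs"
    define M where "M = mset (map (\<lambda>V. (V s, V t)) F)"
    have fstM: "image_mset fst M = mset (map (\<lambda>V. V s) F)"
      and sndM: "image_mset snd M = mset (map (\<lambda>V. V t) F)"
      by (simp_all add: M_def image_mset.compositionality comp_def)
    have Ps: "off_diagonal (\<V> s) = off_diagonal (mset (map (\<lambda>V. V s) Vs))"
      and Pt: "off_diagonal (\<V> t) = off_diagonal (mset (map (\<lambda>V. V t) Vs))"
      using dec s t unfolding vine_decomposition_def by auto
    have sub1: "mset (map (\<lambda>V. V s) F) \<subseteq># off_diagonal (mset (map (\<lambda>V. V s) Vs))"
      unfolding F_def
      by (induction Vs) (auto simp: off_diagonal_def intro: subset_mset.order_trans)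
    have sub2: "mset (map (\<lambda>V. V t) F) \<subseteq># off_diagonal (mset (map (\<lambda>V. V t) Vs))"
      unfolding F_def
      by (induction Vs) (auto simp: off_diagonal_def intro: subset_mset.order_trans)
    have off: "off_diagonal P \<subseteq># P" for P
      by (simp add: off_diagonal_def)
    have M: "M \<in> matchings (\<V> s) (\<V> t)"
      using subset_mset.order_trans[OF sub1[folded Ps] off]
        subset_mset.order_trans[OF sub2[folded Pt] off]
      by (simp add: matchings_def fstM sndM)
    have diag0: "d_inf_diagonal p < \<epsilon>" if "p \<in> diagonal" for p
      using d_inf_diagonal_le[OF that, of p] \<epsilon> by (simp add: d_inf_def)
    have un1: "d_inf_diagonal p < \<epsilon>" if p: "p \<in># \<V> s - image_mset fst M" for p
      using unmatched_le[OF Ps, of p "\<lambda>V. V t"] p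
      by (auto simp: fstM F_def diag0 intro: le_less_trans[OF d_inf_diagonal_le close])
    have un2: "d_inf_diagonal p < \<epsilon>" if p: "p \<in># \<V> t - image_mset snd M" for p
    proof -
      have "F = filter (\<lambda>V. V t \<notin> diagonal \<and> V s \<notin> diagonal) Vs"
        unfolding F_def by (rule filter_cong) auto
      then have "p \<in> diagonal \<or> (\<exists>V\<in>set Vs. p = V t \<and> V s \<in> diagonal)"
        using unmatched_le[OF Pt, of p "\<lambda>V. V s"] p by (simp add: sndM)
      then show ?thesis
        using diag0 close d_inf_diagonal_le d_inf_commute by (metis le_less_trans)
    qed
    have "matching_cost (\<V> s) (\<V> t) M < \<epsilon>"
      unfolding matching_cost_def
    proof (subst Max_less_iff)
      show "\<forall>a\<in>insert 0
       ((\<lambda>(p, q). d_inf p q) ` set_mset M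
        \<union> d_inf_diagonal ` set_mset (\<V> s - image_mset fst M)
        \<union> d_inf_diagonal ` set_mset (\<V> t - image_mset snd M)). a < \<epsilon>"
        using un1 un2 \<epsilon> close by (auto simp: M_def F_def)
    qed auto
    moreover have "bottleneck (\<V> s) (\<V> t) \<le> matching_cost (\<V> s) (\<V> t) M"
      unfolding bottleneck_def
      by (rule cINF_lower[OF _ M])
        (auto intro!: bdd_belowI2[where m = 0] Max_ge simp: matching_cost_def)
    ultimately show "bottleneck (\<V> s) (\<V> t) < \<epsilon>" by linarith
  qed
qed (use dia in auto)

lemma persistence_diagram_dgm:
  assumes "finite K" and C: "\<And>C \<sigma>. ceil = Some C \<Longrightarrow> \<sigma> \<in> K \<Longrightarrow> f \<sigma> \<le> C"
  shows "persistence_diagram (dgm k ceil p K f)"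
proof -
  have fin: "finite {(a, b). a \<in> f ` K \<and> b \<in> f ` K \<and> a < b}"
    by (rule finite_subset[of _ "f ` K \<times> f ` K"]) (use assms in auto)
  show ?thesis
    unfolding persistence_diagram_def dgm_def using C fin assms(1)
    by (auto split: option.splits if_splits simp: in_replicate_mset set_mset_sum)
qed

lemma decomposable_straight_line_vineyard_iff:
  assumes "finite K" and "\<forall>C\<in>set_option ceil. \<forall>\<sigma>\<in>K. f \<sigma> \<le> C \<and> g \<sigma> \<le> C"
  shows "decomposable_vineyard (straight_line_vineyard k ceil d K f g) \<longleftrightarrow>
    (\<exists>Vs. vine_decomposition (straight_line_vineyard k ceil d K f g) Vs)"
proof -
  have "persistence_diagram (straight_line_vineyard k ceil d K f g t)" if "t \<in> {0..1}" for t
    unfolding straight_line_vineyard_def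
    using assms that by (intro persistence_diagram_dgm) (auto intro!: convex_bound_le)
  then show ?thesis
    unfolding decomposable_vineyard_def using vineyard_if_vine_decomposition by blast
qed

end

theory Submission
  imports Defs
begin

text \<open>
  Away from the finitely many times at which two of the values \<open>(1 - t) f \<sigma> + t g \<sigma>\<close> (or the
  ceiling) cross, every vine either rests on the diagonal or moves along a straight line
  \<open>(u t, w t)\<close>, where \<open>u\<close> and \<open>w\<close> are such values; its speed is at most \<open>\<bar>u'\<bar> + \<bar>w'\<bar>\<close>.  So it
  suffices to bound, at one such time, the number of points of the diagram with first coordinate
  \<open>a\<close> by the number of \<open>d\<close>-simplices with value \<open>a\<close>, and the number of points with second
  coordinate \<open>b\<close> by the number of \<open>(d + 1)\<close>-simplices with value \<open>b\<close>.  No pairing of simplices is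
  needed for this: the multiplicities telescope to differences of persistent Betti numbers, and
  those are bounded by the inequality \<open>dim X + dim Y \<le> dim U + dim (X \<inter> Y)\<close> for subspaces of
  \<open>U\<close>.
\<close>

section \<open>Dimensions of subspaces\<close>

context vector_space
begin

text \<open>\<open>dim\<close> is the cardinality of a basis, hence 0 when bases are infinite, so in
  general it is not monotone. A finite set \<open>W\<close> spanning the surroundings, here and in
  the lemmas below, makes all bases involved finite.\<close>

lemma independent_card_le_dim_finite:
  assumes "A \<subseteq> U" "independent A" "U \<subseteq> span W" "finite W"
  shows "finite A \<and> card A \<le> dim U"
proof -
  obtain B where B: "B \<subseteq> U" "independent B" "U \<subseteq> span B" "card B = dim U"
    using basis_exists by blast
  have "finite B"
    using independent_span_bound[OF assms(4) B(2)] B(1) assms(3) by blast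
  then show ?thesis
    using independent_span_bound[of B A] B assms by auto
qed

lemma dim_mono_finite:
  assumes "X \<subseteq> U" "U \<subseteq> span W" "finite W"
  shows "dim X \<le> dim U"
proof -
  obtain B where B: "B \<subseteq> X" "independent B" "X \<subseteq> span B" "card B = dim X"
    using basis_exists by blast
  then show ?thesis
    using independent_card_le_dim_finite[of B U W] assms by auto
qed

lemma dim_le_dim_add_card:
  assumes "X \<subseteq> span (Y \<union> F)" "finite F" "Y \<subseteq> span W" "finite W"
  shows "dim X \<le> dim Y + card F"
proof -
  obtain B where B: "B \<subseteq> Y" "independent B" "Y \<subseteq> span B" "card B = dim Y"
    using basis_exists by blast
  have fin: "finite B"
    using independent_card_le_dim_finite[OF B(1,2) assms(3,4)] by simp
  have "Y \<union> F \<subseteq> span (B \<union> F)"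
    using B(3) span_mono[of B "B \<union> F"] span_superset[of "B \<union> F"] by auto
  then have "X \<subseteq> span (B \<union> F)"
    using assms(1) span_minimal[OF _ subspace_span] by blast
  then have "dim X \<le> card (B \<union> F)"
    using fin assms(2) by (intro dim_le_card) auto
  then show ?thesis
    using card_Un_le[of B F] B(4) by simp
qed

text \<open>A basis \<open>B\<close> of the intersection extends to a basis \<open>BX\<close> of
  \<open>X\<close>. The added vectors \<open>BX - B\<close> together with a basis \<open>BY\<close>
  of \<open>Y\<close> are independent in \<open>U\<close>, and they number
  \<open>dim X - dim (X \<inter> Y) + dim Y\<close>.\<close>

lemma dim_add_dim_le:
  assumes "subspace X" "subspace Y" "X \<subseteq> U" "Y \<subseteq> U" "U \<subseteq> span W" "finite W"
  shows "dim X + dim Y \<le> dim U + dim (X \<inter> Y)"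
proof -
  obtain B where B: "B \<subseteq> X \<inter> Y" "independent B" "X \<inter> Y \<subseteq> span B" "card B = dim (X \<inter> Y)"
    using basis_exists by blast
  obtain BX where BX: "B \<subseteq> BX" "BX \<subseteq> X" "independent BX" "X \<subseteq> span BX"
    using maximal_independent_subset_extend[of B X] B by auto
  obtain BY where BY: "BY \<subseteq> Y" "independent BY" "Y \<subseteq> span BY" "card BY = dim Y"
    using basis_exists by blast
  have finX: "finite BX" and finY: "finite BY"
    using independent_card_le_dim_finite[of _ U W] BX BY assms by blast+
  have "independent (BY \<union> E) \<and> BY \<inter> E = {}" if "finite E" "E \<subseteq> BX - B" for E
    using that
  proof induction
    case empty
    then show ?case using BY by simp
  next
    case (insert e E)
    \<comment> \<open>Otherwise \<open>e = y + z\<close> with \<open>y\<close> in \<open>Y\<close>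
      and \<open>z\<close> in \<open>span E\<close>. Then \<open>y = e - z\<close> also lies in
      \<open>X\<close>, hence in \<open>span B\<close>, and \<open>e\<close> depends on other
      vectors of \<open>BX\<close>.\<close>
    have "e \<notin> span (BY \<union> E)"
    proof
      assume "e \<in> span (BY \<union> E)"
      then obtain y z where yz: "e = y + z" "y \<in> span BY" "z \<in> span E"
        unfolding span_Un by auto
      have "y \<in> Y" using yz(2) BY(1) assms(2) span_minimal by blast
      moreover have "z \<in> X"
        using yz(3) insert.prems BX(2) assms(1) span_minimal[of E X] by blast
      then have "y \<in> X"
        using yz(1) insert.prems BX(2) assms(1) subspace_diff[of X e z]
        by (auto simp: subset_iff)
      ultimately have "y \<in> span B" using B(3) by blast
      then have "y \<in> span (B \<union> E)" "z \<in> span (B \<union> E)"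
        using yz(3) span_mono[of _ "B \<union> E"] by blast+
      then have "e \<in> span (B \<union> E)"
        using yz(1) span_add by blast
      moreover have "B \<union> E \<subseteq> BX - {e}"
        using insert BX(1) by auto
      ultimately have "e \<in> span (BX - {e})"
        using span_mono by blast
      then show False
        using BX(3) insert.prems unfolding dependent_def by blast
    qed
    then show ?case
      using insert independent_insertI[of e "BY \<union> E"] span_superset[of "BY \<union> E"] by auto
  qed
  from this[of "BX - B"] finX
  have ind: "independent (BY \<union> (BX - B))" and disj: "BY \<inter> (BX - B) = {}" by auto
  have "card (BY \<union> (BX - B)) \<le> dim U"
    using independent_card_le_dim_finite[OF _ ind assms(5,6)] BX(2) BY(1) assms(3,4) by blast
  moreover have "card (BX - B) = card BX - card B" "card B \<le> card BX"
    using finX BX(1) by (auto intro: card_Diff_subset finite_subset card_mono)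
  moreover have "card BX = dim X"
    using BX by (intro basis_card_eq_dim)
  ultimately show ?thesis
    using B(4) BY(4) finX finY disj by (simp add: card_Un_disjoint)
qed

end

section \<open>Chains, cycles and boundaries\<close>

definition elem_chain :: "'v set \<Rightarrow> 'v set \<Rightarrow> 'k::field" where
  "elem_chain \<sigma> = (\<lambda>\<tau>. if \<tau> = \<sigma> then 1 else 0)"

lemma subspace_chains: "chain.subspace (chains p L)"
  by (rule chain.subspaceI) (auto simp: chains_def chain_scale_def; metis add_0)+

lemma chains_mono: "L \<subseteq> M \<Longrightarrow> chains p L \<subseteq> chains p M"
  by (auto simp: chains_def)

text \<open>Induction on \<open>N\<close>: setting the coefficient at the new simplex to 0 changes a
  chain by at most a multiple of one elementary chain.\<close>

lemma chains_subset_span: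
  assumes "finite N"
  shows "chains p (L \<union> N) \<subseteq> chain.span (chains p L \<union> elem_chain ` {\<sigma>\<in>N. simplex_dim \<sigma> = p})"
  using assms
proof induction
  case empty
  then show ?case using chain.span_superset by auto
next
  case (insert \<sigma> N)
  let ?S = "chain.span (chains p L \<union> elem_chain ` {\<tau>\<in>insert \<sigma> N. simplex_dim \<tau> = p})"
  show ?case
  proof
    fix c :: "'a set \<Rightarrow> 'b" assume c: "c \<in> chains p (L \<union> insert \<sigma> N)"
    have "c(\<sigma> := 0) \<in> chains p (L \<union> N)"
      using c by (auto simp: chains_def)
    then have 1: "c(\<sigma> := 0) \<in> ?S"
      using insert.IH chain.span_mono[of
        "chains p L \<union> elem_chain ` {\<tau>\<in>N. simplex_dim \<tau> = p}"
        "chains p L \<union> elem_chain ` {\<tau>\<in>insert \<sigma> N. simplex_dim \<tau> = p}"] by blast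
    show "c \<in> ?S"
    proof (cases "c \<sigma> = 0")
      case True
      then have "c(\<sigma> := 0) = c" by auto
      with 1 show ?thesis by simp
    next
      case False
      then have "simplex_dim \<sigma> = p" using c by (auto simp: chains_def)
      then have "chain_scale (c \<sigma>) (elem_chain \<sigma>) \<in> ?S"
        by (intro chain.span_scale chain.span_base) auto
      moreover have "c = c(\<sigma> := 0) + chain_scale (c \<sigma>) (elem_chain \<sigma>)"
        by (auto simp: chain_scale_def elem_chain_def)
      ultimately show ?thesis using 1 chain.span_add by metis
    qed
  qed
qed

text \<open>Provides the finite spanning set that the dimension lemmas ask for; the space of all
  functions on sets of vertices may be infinite-dimensional.\<close>

lemma chains_finite_span:
  assumes "finite K"
  shows "\<exists>W. finite W \<and> chains p K \<subseteq> chain.span (W :: ('v set \<Rightarrow> 'k::field) set)"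
proof -
  have "chains p {} = {0 :: 'v set \<Rightarrow> 'k}" by (auto simp: chains_def fun_eq_iff)
  then have "chains p K \<subseteq> chain.span ({0 :: 'v set \<Rightarrow> 'k}
      \<union> elem_chain ` {\<sigma>\<in>K. simplex_dim \<sigma> = p})"
    using chains_subset_span[OF assms, of p "{}", where ?'b = 'k] by (simp only: Un_empty_left)
  then show ?thesis
    using assms by (intro exI[of _ "{0} \<union> elem_chain ` {\<sigma>\<in>K. simplex_dim \<sigma> = p}"]) simp
qed

lemma linear_boundary: "Vector_Spaces.linear chain_scale chain_scale (boundary L)"
proof unfold_locales
qed (auto simp: boundary_def chain_scale_def algebra_simps sum.distrib sum_distrib_left fun_eq_iff)

text \<open>Simplices outside \<open>L\<close> carry coefficient 0. Hence one fixed linear map, the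
  boundary of the ambient complex, serves for all subcomplexes, and their cycles and boundaries can
  be compared.\<close>

lemma boundary_superset:
  assumes "finite M" "L \<subseteq> M" "c \<in> chains p L"
  shows "boundary M c = boundary L c"
  unfolding boundary_def using assms
  by (intro ext if_cong refl sum.mono_neutral_right) (auto simp: chains_def)

lemma cycles_eq:
  assumes "finite K" "L \<subseteq> K"
  shows "cycles p L = chains p L \<inter> {c. boundary K c = 0}"
  unfolding cycles_def by (auto simp: boundary_superset[OF assms, of _ p])

lemma boundaries_eq:
  assumes "finite K" "L \<subseteq> K"
  shows "boundaries p L = boundary K ` chains (Suc p) L"
  unfolding boundaries_def
  by (intro image_cong refl boundary_superset[OF assms, symmetric])

lemma subspace_cycles: "chain.subspace (cycles p L)"
proof -
  have "cycles p L = chains p L \<inter> {c. boundary L c = 0}"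
    by (auto simp: cycles_def)
  moreover have "module_hom chain_scale chain_scale (boundary L)"
    using linear_boundary by (rule Vector_Spaces.linear.axioms)
  ultimately show ?thesis
    by (metis chain.subspace_inter module_hom.subspace_kernel subspace_chains)
qed

lemma subspace_boundaries: "chain.subspace (boundaries p L)"
  unfolding boundaries_def
  by (rule module_hom.subspace_image[OF Vector_Spaces.linear.axioms(3)[OF linear_boundary]
        subspace_chains])

text \<open>The images of a finite spanning set of chains span. As \<open>K\<close> is only assumed
  finite, a boundary need not be supported on \<open>K\<close>, so a spanning set of
  \<open>chains p K\<close> would not do.\<close>

lemma boundaries_finite_span:
  assumes "finite K"
  shows "\<exists>W. finite W \<and> boundaries p K \<subseteq> chain.span (W :: ('v::linorder set \<Rightarrow> 'k::field) set)"
proof -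
  obtain W :: "('v set \<Rightarrow> 'k) set" where W: "finite W" "chains (Suc p) K \<subseteq> chain.span W"
    using chains_finite_span[OF assms] by blast
  have "boundaries p K \<subseteq> chain.span (boundary K ` W)"
    using W(2) unfolding boundaries_def
      module_hom.span_image[OF Vector_Spaces.linear.axioms(3)[OF linear_boundary]] by blast
  with W(1) show ?thesis by blast
qed

lemma cycles_mono: "finite K \<Longrightarrow> L \<subseteq> M \<Longrightarrow> M \<subseteq> K \<Longrightarrow> cycles p L \<subseteq> cycles p M"
  using chains_mono[of L M p] by (auto simp: cycles_eq)

lemma boundaries_mono: "finite K \<Longrightarrow> L \<subseteq> M \<Longrightarrow> M \<subseteq> K \<Longrightarrow> boundaries p L \<subseteq> boundaries p M"
  using chains_mono[of L M "Suc p"] by (auto simp: boundaries_eq[of K])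

text \<open>Cycles of \<open>L\<close> are the cycles of \<open>M\<close> that are chains on
  \<open>L\<close>. So the cycles grow by no more than the chains do, and each new
  \<open>p\<close>-simplex adds at most one dimension of chains.\<close>

lemma dim_cycles_le:
  fixes L M :: "'v::linorder set set"
  assumes "finite M" "L \<subseteq> M"
  shows "chain.dim (cycles p M :: ('v set \<Rightarrow> 'k::field) set)
    \<le> chain.dim (cycles p L :: ('v set \<Rightarrow> 'k) set) + card {\<sigma>\<in>M - L. simplex_dim \<sigma> = p}"
proof -
  let ?C = "\<lambda>L. chains p L :: ('v set \<Rightarrow> 'k) set"
  let ?Z = "\<lambda>L. cycles p L :: ('v set \<Rightarrow> 'k) set"
  obtain W where W: "finite W" "?C M \<subseteq> chain.span W"
    using chains_finite_span[OF assms(1)] by blast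
  have "?C L \<inter> ?Z M = ?Z L"
    using chains_mono[OF assms(2), where ?'b = 'k]
    unfolding cycles_eq[OF assms] cycles_eq[OF assms(1) order_refl] by blast
  then have 1: "chain.dim (?C L) + chain.dim (?Z M) \<le> chain.dim (?C M) + chain.dim (?Z L)"
    using chain.dim_add_dim_le[of "?C L" "?Z M" "?C M" W] W chains_mono[OF assms(2)]
    by (simp add: subspace_chains subspace_cycles) (auto simp: cycles_def)
  have "L \<union> (M - L) = M" using assms by auto
  then have "chain.dim (?C M) \<le> chain.dim (?C L)
      + card (elem_chain ` {\<sigma>\<in>M - L. simplex_dim \<sigma> = p} :: ('v set \<Rightarrow> 'k) set)"
    using chains_subset_span[of "M - L" p L, where ?'b = 'k] W
      chains_mono[OF assms(2), of p, where ?'b = 'k] assms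
    by (intro chain.dim_le_dim_add_card[of _ _ _ W]) auto
  also have "\<dots> \<le> chain.dim (?C L) + card {\<sigma>\<in>M - L. simplex_dim \<sigma> = p}"
    using assms by (intro add_left_mono card_image_le) auto
  finally show ?thesis using 1 by linarith
qed

text \<open>The boundaries of \<open>M\<close> are generated by those of \<open>L\<close> and the
  boundaries of the new simplices.\<close>

lemma dim_boundaries_le:
  fixes L M :: "'v::linorder set set"
  assumes "finite M" "L \<subseteq> M"
  shows "chain.dim (boundaries p M :: ('v set \<Rightarrow> 'k::field) set)
    \<le> chain.dim (boundaries p L :: ('v set \<Rightarrow> 'k) set)
      + card {\<sigma>\<in>M - L. simplex_dim \<sigma> = Suc p}"
proof -
  let ?E = "elem_chain ` {\<sigma>\<in>M - L. simplex_dim \<sigma> = Suc p} :: ('v set \<Rightarrow> 'k) set"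
  let ?B = "\<lambda>L. boundaries p L :: ('v set \<Rightarrow> 'k) set"
  obtain W where W: "finite W" "?B M \<subseteq> chain.span W"
    using boundaries_finite_span[OF assms(1)] by blast
  have "L \<union> (M - L) = M" using assms by auto
  then have "chains (Suc p) M \<subseteq> chain.span (chains (Suc p) L \<union> ?E)"
    using chains_subset_span[of "M - L" "Suc p" L, where ?'b = 'k] assms by auto
  then have "?B M \<subseteq> chain.span (boundary M ` (chains (Suc p) L \<union> ?E))"
    unfolding boundaries_def
      module_hom.span_image[OF Vector_Spaces.linear.axioms(3)[OF linear_boundary]] by blast
  then have "?B M \<subseteq> chain.span (?B L \<union> boundary M ` ?E)"
    by (simp add: image_Un boundaries_eq[OF assms])
  then have "chain.dim (?B M) \<le> chain.dim (?B L) + card (boundary M ` ?E)"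
    using W boundaries_mono[OF assms(1,2) order_refl] assms
    by (intro chain.dim_le_dim_add_card[of _ _ _ W]) auto
  also have "card (boundary M ` ?E) \<le> card ?E"
    using assms by (intro card_image_le) auto
  also have "card ?E \<le> card {\<sigma>\<in>M - L. simplex_dim \<sigma> = Suc p}"
    using assms by (intro card_image_le) auto
  finally show ?thesis by simp
qed

section \<open>Persistent Betti numbers\<close>

text \<open>The subtrahend is the smaller dimension, so the natural subtraction in the definition
  does not truncate.\<close>

lemma persistent_betti_eq:
  fixes L M :: "'v::linorder set set"
  assumes "finite L"
  shows "int (persistent_betti TYPE('k::field) p L M) =
    int (chain.dim (cycles p L :: ('v set \<Rightarrow> 'k) set))
    - int (chain.dim (cycles p L \<inter> boundaries p M :: ('v set \<Rightarrow> 'k) set))"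
proof -
  obtain W :: "('v set \<Rightarrow> 'k) set" where W: "finite W" "chains p L \<subseteq> chain.span W"
    using chains_finite_span[OF assms] by blast
  have "cycles p L \<subseteq> (chains p L :: ('v set \<Rightarrow> 'k) set)" by (auto simp: cycles_def)
  then show ?thesis
    unfolding persistent_betti_def
    using chain.dim_mono_finite[of "cycles p L \<inter> boundaries p M" "cycles p L" W] W
    by (simp add: of_nat_diff)
qed

text \<open>The image of homology in that of \<open>M\<close> can only grow with \<open>L\<close>.
  In terms of dimensions this is \<open>dim_add_dim_le\<close> for the cycles of \<open>L\<close>
  and those cycles of \<open>L'\<close> that bound in \<open>M\<close>.\<close>

lemma persistent_betti_mono:
  fixes L L' M :: "'v::linorder set set"
  assumes "finite L'" "L \<subseteq> L'"
  shows "persistent_betti TYPE('k::field) p L M \<le> persistent_betti TYPE('k) p L' M"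
proof -
  let ?Z = "\<lambda>L. cycles p L :: ('v set \<Rightarrow> 'k) set"
  let ?B = "\<lambda>L. boundaries p L :: ('v set \<Rightarrow> 'k) set"
  obtain W where W: "finite W" "chains p L' \<subseteq> chain.span (W :: ('v set \<Rightarrow> 'k) set)"
    using chains_finite_span[OF assms(1)] by blast
  have sub: "?Z L \<subseteq> ?Z L'" using cycles_mono[OF assms order_refl] .
  then have int: "?Z L \<inter> (?Z L' \<inter> ?B M) = ?Z L \<inter> ?B M" by auto
  have "?Z L' \<subseteq> chain.span W" using W by (auto simp: cycles_def)
  then have "chain.dim (?Z L) + chain.dim (?Z L' \<inter> ?B M)
      \<le> chain.dim (?Z L') + chain.dim (?Z L \<inter> ?B M)"
    using chain.dim_add_dim_le[of "?Z L" "?Z L' \<inter> ?B M" "?Z L'" W] sub W(1)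
    unfolding int by (simp add: subspace_cycles subspace_boundaries chain.subspace_inter)
  then have "int (persistent_betti TYPE('k) p L M) \<le> int (persistent_betti TYPE('k) p L' M)"
    using assms finite_subset[OF assms(2,1)] by (simp add: persistent_betti_eq)
  then show ?thesis by simp
qed

text \<open>This is the nonnegativity of pair multiplicities. The dimensions of the cycle spaces
  cancel, and \<open>dim_add_dim_le\<close> is applied inside the space of cycles of
  \<open>L'\<close> that bound in \<open>M'\<close>.\<close>

lemma persistent_betti_diff_mono:
  fixes L L' M M' :: "'v::linorder set set"
  assumes "finite L'" "L \<subseteq> L'" "finite M'" "M \<subseteq> M'"
  shows "int (persistent_betti TYPE('k::field) p L' M') - int (persistent_betti TYPE('k) p L M')
    \<le> int (persistent_betti TYPE('k) p L' M) - int (persistent_betti TYPE('k) p L M)"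
proof -
  let ?Z = "\<lambda>L. cycles p L :: ('v set \<Rightarrow> 'k) set"
  let ?B = "\<lambda>L. boundaries p L :: ('v set \<Rightarrow> 'k) set"
  obtain W where W: "finite W" "chains p L' \<subseteq> chain.span (W :: ('v set \<Rightarrow> 'k) set)"
    using chains_finite_span[OF assms(1)] by blast
  have sub: "?Z L \<subseteq> ?Z L'" "?B M \<subseteq> ?B M'"
    using cycles_mono[OF assms(1,2) order_refl] boundaries_mono[OF assms(3,4) order_refl] .
  then have int: "(?Z L' \<inter> ?B M) \<inter> (?Z L \<inter> ?B M') = ?Z L \<inter> ?B M" by auto
  have "?Z L' \<subseteq> chain.span W" using W by (auto simp: cycles_def)
  then have "?Z L' \<inter> ?B M' \<subseteq> chain.span W" by auto
  then have "chain.dim (?Z L' \<inter> ?B M) + chain.dim (?Z L \<inter> ?B M')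
      \<le> chain.dim (?Z L' \<inter> ?B M') + chain.dim (?Z L \<inter> ?B M)"
    using chain.dim_add_dim_le[of "?Z L' \<inter> ?B M" "?Z L \<inter> ?B M'" "?Z L' \<inter> ?B M'" W] sub W(1)
    unfolding int by (simp add: subspace_cycles subspace_boundaries chain.subspace_inter) blast
  then show ?thesis
    using assms finite_subset[OF assms(2,1)] by (simp add: persistent_betti_eq)
qed

text \<open>The difference is the growth of the cycles minus the growth of the cycles bounding in
  \<open>L'\<close>. The latter is nonnegative, and the former is bounded by
  \<open>dim_cycles_le\<close>.\<close>

lemma persistent_betti_births:
  fixes L L' :: "'v::linorder set set"
  assumes "finite L'" "L \<subseteq> L'"
  shows "int (persistent_betti TYPE('k::field) p L' L') - int (persistent_betti TYPE('k) p L L')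
    \<le> int (card {\<sigma>\<in>L' - L. simplex_dim \<sigma> = p})"
proof -
  let ?Z = "\<lambda>L. cycles p L :: ('v set \<Rightarrow> 'k) set"
  let ?B = "\<lambda>L. boundaries p L :: ('v set \<Rightarrow> 'k) set"
  obtain W where W: "finite W" "chains p L' \<subseteq> chain.span (W :: ('v set \<Rightarrow> 'k) set)"
    using chains_finite_span[OF assms(1)] by blast
  have "?Z L' \<subseteq> chain.span W" using W by (auto simp: cycles_def)
  then have "chain.dim (?Z L \<inter> ?B L') \<le> chain.dim (?Z L' \<inter> ?B L')"
    using cycles_mono[OF assms order_refl, of p, where ?'b = 'k] W(1)
    by (intro chain.dim_mono_finite[of _ _ W]) auto
  then show ?thesis
    using dim_cycles_le[OF assms, of p, where ?'k = 'k] assms finite_subset[OF assms(2,1)]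
    by (simp add: persistent_betti_eq)
qed

text \<open>The difference counts cycles of \<open>L\<close> that newly become boundaries. By
  \<open>dim_add_dim_le\<close> inside the boundaries of \<open>M\<close> it is at most the growth
  of the boundaries.\<close>

lemma persistent_betti_deaths:
  fixes L M :: "'v::linorder set set"
  assumes "finite M" "L \<subseteq> M"
  shows "int (persistent_betti TYPE('k::field) p L L) - int (persistent_betti TYPE('k) p L M)
    \<le> int (card {\<sigma>\<in>M - L. simplex_dim \<sigma> = Suc p})"
proof -
  let ?Z = "cycles p L :: ('v set \<Rightarrow> 'k) set"
  let ?B = "\<lambda>L. boundaries p L :: ('v set \<Rightarrow> 'k) set"
  obtain W where W: "finite W" "?B M \<subseteq> chain.span W"
    using boundaries_finite_span[OF assms(1)] by blast
  have sub: "?B L \<subseteq> ?B M" using boundaries_mono[OF assms order_refl] .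
  then have "?B L \<inter> (?Z \<inter> ?B M) = ?Z \<inter> ?B L" by auto
  then have "chain.dim (?B L) + chain.dim (?Z \<inter> ?B M)
      \<le> chain.dim (?B M) + chain.dim (?Z \<inter> ?B L)"
    using chain.dim_add_dim_le[of "?B L" "?Z \<inter> ?B M" "?B M" W] sub W
    by (simp add: subspace_cycles subspace_boundaries chain.subspace_inter)
  then show ?thesis
    using dim_boundaries_le[OF assms, of p, where ?'k = 'k] assms finite_subset[OF assms(2,1)]
    by (simp add: persistent_betti_eq)
qed

section \<open>Births and deaths in a persistence diagram\<close>

text \<open>Telescoping over a finite ordered set without enumerating it:
  \<open>Y \<inter> {..<y}\<close> is the closed initial segment of the predecessor of
  \<open>y\<close>, or empty. The induction removes the maximum.\<close>

lemma sum_telescope_initial_segments: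
  fixes \<psi> :: "'a::linorder set \<Rightarrow> int"
  assumes "finite Y"
  shows "(\<Sum>y\<in>Y. \<psi> (Y \<inter> {..y}) - \<psi> (Y \<inter> {..<y})) = \<psi> Y - \<psi> {}"
  using assms
proof (induction rule: finite_linorder_max_induct)
  case empty
  then show ?case by simp
next
  case (insert b A)
  have *: "insert b A \<inter> {..y} = A \<inter> {..y}" "insert b A \<inter> {..<y} = A \<inter> {..<y}" if "y \<in> A" for y
    using insert.hyps(2) that by fastforce+
  have "insert b A \<inter> {..b} = insert b A" "insert b A \<inter> {..<b} = A" "b \<notin> A"
    using insert.hyps(2) by force+
  then show ?case
    using insert by (simp add: * cong: sum.cong)
qed

context
  fixes K :: "'v::linorder set set" and h :: "'v set \<Rightarrow> real" and p :: nat
  assumes fin: "finite K"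
begin

lemma strict_subset_sublevel: "strict_sublevel K h a \<subseteq> sublevel K h a"
  by (auto simp: strict_sublevel_def sublevel_def)

lemma finite_sublevel: "finite (sublevel K h a)" "finite (strict_sublevel K h a)"
  using fin by (auto simp: strict_sublevel_def sublevel_def)

text \<open>By \<open>persistent_betti_diff_mono\<close> the integer under \<open>nat\<close> is
  nonnegative; without truncation the multiplicities can telescope.\<close>

lemma int_pair_multiplicity:
  "int (pair_multiplicity TYPE('k::field) p K h a b) =
    (int (persistent_betti TYPE('k) p (sublevel K h a) (strict_sublevel K h b))
      - int (persistent_betti TYPE('k) p (strict_sublevel K h a) (strict_sublevel K h b)))
    - (int (persistent_betti TYPE('k) p (sublevel K h a) (sublevel K h b))
      - int (persistent_betti TYPE('k) p (strict_sublevel K h a) (sublevel K h b)))"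
  unfolding pair_multiplicity_def
  using persistent_betti_diff_mono[where ?'k = 'k, OF finite_sublevel(1)[of a]
      strict_subset_sublevel[of a] finite_sublevel(1)[of b] strict_subset_sublevel[of b], of p]
  by simp

lemma int_essential_multiplicity:
  "int (essential_multiplicity TYPE('k::field) p K h a) =
    int (persistent_betti TYPE('k) p (sublevel K h a) K)
    - int (persistent_betti TYPE('k) p (strict_sublevel K h a) K)"
  unfolding essential_multiplicity_def
  using persistent_betti_mono[where ?'k = 'k, OF finite_sublevel(1)[of a]
      strict_subset_sublevel[of a], of p K]
  by simp

lemma sublevel_diff: "sublevel K h a - strict_sublevel K h a = {\<sigma>\<in>K. h \<sigma> = a}"
  by (auto simp: sublevel_def strict_sublevel_def)

text \<open>For fixed \<open>a\<close> the multiplicities telescope over the death values, and the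
  essential multiplicity cancels the term at \<open>K\<close>. What remains is the increase of the
  Betti number from the strict sublevel set at \<open>a\<close>, bounded by
  \<open>persistent_betti_births\<close>.\<close>

lemma births_le:
  "(\<Sum>b\<in>{b\<in>h ` K. a < b}. pair_multiplicity TYPE('k::field) p K h a b)
    + essential_multiplicity TYPE('k) p K h a
    \<le> card {\<sigma>\<in>K. h \<sigma> = a \<and> simplex_dim \<sigma> = p}"
proof -
  define Y where "Y = {b\<in>h ` K. a < b}"
  define \<phi> where "\<phi> M = int (persistent_betti TYPE('k) p (strict_sublevel K h a) M)
    - int (persistent_betti TYPE('k) p (sublevel K h a) M)" for M
  \<comment> \<open>Keeping all simplices up to \<open>a\<close> makes the empty set of values
    correspond to the sublevel set at \<open>a\<close>, and \<open>Y\<close> to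
    \<open>K\<close>.\<close>
  define \<psi> where "\<psi> W = \<phi> {\<sigma>\<in>K. h \<sigma> \<le> a \<or> h \<sigma> \<in> W}" for W
  have finY: "finite Y" using fin by (simp add: Y_def)
  have \<psi>: "\<psi> (Y \<inter> {..b}) = \<phi> (sublevel K h b)" "\<psi> (Y \<inter> {..<b}) = \<phi> (strict_sublevel K h b)"
    if "b \<in> Y" for b
    using that unfolding \<psi>_def sublevel_def strict_sublevel_def Y_def
    by (auto intro!: arg_cong[where f = \<phi>])
  have \<psi>0: "\<psi> {} = \<phi> (sublevel K h a)" "\<psi> Y = \<phi> K"
    unfolding \<psi>_def sublevel_def Y_def by (auto intro!: arg_cong[where f = \<phi>])
  have "int (\<Sum>b\<in>Y. pair_multiplicity TYPE('k) p K h a b) =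
      (\<Sum>b\<in>Y. \<psi> (Y \<inter> {..b}) - \<psi> (Y \<inter> {..<b}))"
    unfolding of_nat_sum by (intro sum.cong refl) (simp add: \<psi> int_pair_multiplicity \<phi>_def)
  also have "\<dots> = \<phi> K - \<phi> (sublevel K h a)"
    using sum_telescope_initial_segments[OF finY] by (simp add: \<psi>0)
  finally have "int ((\<Sum>b\<in>Y. pair_multiplicity TYPE('k) p K h a b)
      + essential_multiplicity TYPE('k) p K h a) = - \<phi> (sublevel K h a)"
    by (simp add: int_essential_multiplicity \<phi>_def)
  also have "\<dots> \<le> int (card {\<sigma>\<in>sublevel K h a - strict_sublevel K h a. simplex_dim \<sigma> = p})"
    unfolding \<phi>_def using persistent_betti_births[OF finite_sublevel(1) strict_subset_sublevel]
    by simp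
  also have "{\<sigma>\<in>sublevel K h a - strict_sublevel K h a. simplex_dim \<sigma> = p}
      = {\<sigma>\<in>K. h \<sigma> = a \<and> simplex_dim \<sigma> = p}"
    by (auto simp: sublevel_diff)
  finally show ?thesis unfolding Y_def by linarith
qed

text \<open>For fixed \<open>b\<close> the telescoping runs over the birth values and ends at the
  classes alive just before \<open>b\<close> that die at \<open>b\<close>, bounded by
  \<open>persistent_betti_deaths\<close>.\<close>

lemma deaths_le:
  "(\<Sum>a\<in>{a\<in>h ` K. a < b}. pair_multiplicity TYPE('k::field) p K h a b)
    \<le> card {\<sigma>\<in>K. h \<sigma> = b \<and> simplex_dim \<sigma> = Suc p}"
proof -
  define Y where "Y = {a\<in>h ` K. a < b}"
  define \<phi> where "\<phi> L = int (persistent_betti TYPE('k) p L (strict_sublevel K h b))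
    - int (persistent_betti TYPE('k) p L (sublevel K h b))" for L
  define \<psi> where "\<psi> W = \<phi> {\<sigma>\<in>K. h \<sigma> \<in> W}" for W
  have finY: "finite Y" using fin by (simp add: Y_def)
  have \<psi>: "\<psi> (Y \<inter> {..a}) = \<phi> (sublevel K h a)" "\<psi> (Y \<inter> {..<a}) = \<phi> (strict_sublevel K h a)"
    if "a \<in> Y" for a
    using that unfolding \<psi>_def sublevel_def strict_sublevel_def Y_def
    by (auto intro!: arg_cong[where f = \<phi>])
  have "\<psi> Y = \<phi> (strict_sublevel K h b)"
    unfolding \<psi>_def strict_sublevel_def Y_def by (auto intro!: arg_cong[where f = \<phi>])
  \<comment> \<open>The empty complex has only the zero cycle, so both of its Betti numbers are
    0.\<close>
  moreover have "\<psi> {} \<ge> 0"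
  proof -
    have "cycles p {} = {0 :: 'v set \<Rightarrow> 'k}"
      by (auto simp: cycles_def chains_def boundary_def fun_eq_iff)
    moreover have "chain.dim {0 :: 'v set \<Rightarrow> 'k} = 0"
      using chain.dim_le_card[of "{0}" "{}"] by simp
    ultimately show ?thesis by (simp add: \<psi>_def \<phi>_def persistent_betti_def)
  qed
  moreover have "int (\<Sum>a\<in>Y. pair_multiplicity TYPE('k) p K h a b) =
      (\<Sum>a\<in>Y. \<psi> (Y \<inter> {..a}) - \<psi> (Y \<inter> {..<a}))"
    unfolding of_nat_sum by (intro sum.cong refl) (simp add: \<psi> int_pair_multiplicity \<phi>_def)
  ultimately have "int (\<Sum>a\<in>Y. pair_multiplicity TYPE('k) p K h a b)
      \<le> \<phi> (strict_sublevel K h b)"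
    using sum_telescope_initial_segments[OF finY, of \<psi>] by linarith
  also have "\<dots> \<le> int (card {\<sigma>\<in>sublevel K h b - strict_sublevel K h b. simplex_dim \<sigma> = Suc p})"
    unfolding \<phi>_def using persistent_betti_deaths[OF finite_sublevel(1) strict_subset_sublevel] .
  also have "{\<sigma>\<in>sublevel K h b - strict_sublevel K h b. simplex_dim \<sigma> = Suc p}
      = {\<sigma>\<in>K. h \<sigma> = b \<and> simplex_dim \<sigma> = Suc p}"
    by (auto simp: sublevel_diff)
  finally show ?thesis unfolding Y_def by linarith
qed

section \<open>Weighted sums over the points of a diagram\<close>

lemma sum_card_fibres:
  fixes r :: "real \<Rightarrow> real"
  shows "(\<Sum>x\<in>h ` K. r x * real (card {\<sigma>\<in>K. h \<sigma> = x \<and> P \<sigma>})) = (\<Sum>\<sigma> | \<sigma> \<in> K \<and> P \<sigma>. r (h \<sigma>))"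
proof -
  have "(\<Sum>x\<in>h ` K. r x * real (card {\<sigma>\<in>K. h \<sigma> = x \<and> P \<sigma>}))
      = (\<Sum>x\<in>h ` K. \<Sum>\<sigma> | \<sigma> \<in> {\<sigma>\<in>K. P \<sigma>} \<and> h \<sigma> = x. r (h \<sigma>))"
    by (intro sum.cong refl) (auto simp: mult.commute conj_ac)
  also have "\<dots> = (\<Sum>\<sigma> | \<sigma> \<in> K \<and> P \<sigma>. r (h \<sigma>))"
    using fin by (intro sum.group) auto
  finally show ?thesis .
qed

lemma sum_mset_sum_replicate:
  fixes c :: "'b \<Rightarrow> real"
  assumes "finite A"
  shows "sum_mset (image_mset c (\<Sum>x\<in>A. replicate_mset (m x) (q x))) = (\<Sum>x\<in>A. real (m x) * c (q x))"
  using assms by induction auto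

text \<open>In the application \<open>r x\<close> is the speed of the track with value
  \<open>x\<close>. First coordinates are charged to \<open>p\<close>-simplices by
  \<open>births_le\<close>, second coordinates to \<open>(p + 1)\<close>-simplices by
  \<open>deaths_le\<close>; a ceiling has weight 0.\<close>

lemma sum_dgm_le:
  fixes r :: "real \<Rightarrow> real"
  assumes r: "\<And>x. r x \<ge> 0" and C: "\<And>C. ceil = Some C \<Longrightarrow> r C = 0"
  shows "(\<Sum>(x, y)\<in>#dgm TYPE('k::field) ceil p K h. r x + r y)
    \<le> (\<Sum>\<sigma> | \<sigma> \<in> K \<and> simplex_dim \<sigma> \<in> {p, p + 1}. r (h \<sigma>))"
proof -
  let ?X = "h ` K"
  define m where "m a b = real (pair_multiplicity TYPE('k) p K h a b)" for a b
  define e where "e a = real (essential_multiplicity TYPE('k) p K h a)" for a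
  have finX: "finite ?X" using fin by simp
  have pairs: "{(a, b). a \<in> ?X \<and> b \<in> ?X \<and> a < b} = (SIGMA a:?X. {b\<in>?X. a < b})" by auto
  have "(\<Sum>(x, y)\<in>#dgm TYPE('k) ceil p K h. r x + r y)
      \<le> (\<Sum>(a, b)\<in>(SIGMA a:?X. {b\<in>?X. a < b}). m a b * (r a + r b)) + (\<Sum>a\<in>?X. e a * r a)"
  proof -
    have 1: "(\<Sum>(x, y)\<in>#(\<Sum>(a, b)\<in>(SIGMA a:?X. {b\<in>?X. a < b}).
          replicate_mset (pair_multiplicity TYPE('k) p K h a b) (a, b)). r x + r y)
        = (\<Sum>(a, b)\<in>(SIGMA a:?X. {b\<in>?X. a < b}). m a b * (r a + r b))"
      using sum_mset_sum_replicate[of "SIGMA a:?X. {b\<in>?X. a < b}" "\<lambda>(x, y). r x + r y"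
          "\<lambda>(a, b). pair_multiplicity TYPE('k) p K h a b" "\<lambda>x. x"] finX
      by (simp add: split_def m_def)
    have 2: "(\<Sum>(x, y)\<in>#(\<Sum>a\<in>?X. replicate_mset (essential_multiplicity TYPE('k) p K h a) (a, C)).
          r x + r y) = (\<Sum>a\<in>?X. e a * r a)" if "ceil = Some C" for C
      using C[OF that] sum_mset_sum_replicate[OF finX, of "\<lambda>(x, y). r x + r y"
          "\<lambda>a. essential_multiplicity TYPE('k) p K h a" "\<lambda>a. (a, C)"]
      by (simp add: e_def)
    \<comment> \<open>If essential classes are omitted from the diagram, their sum is a nonnegative
      surplus.\<close>
    have "(\<Sum>a\<in>?X. e a * r a) \<ge> 0"
      by (intro sum_nonneg mult_nonneg_nonneg r) (simp add: e_def)
    then show ?thesis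
      unfolding dgm_def pairs image_mset_union sum_mset.union 1
      using 2 by (cases ceil) auto
  qed
  also have "(\<Sum>(a, b)\<in>(SIGMA a:?X. {b\<in>?X. a < b}). m a b * (r a + r b))
      = (\<Sum>a\<in>?X. \<Sum>b\<in>{b\<in>?X. a < b}. m a b * r a) + (\<Sum>a\<in>?X. \<Sum>b\<in>{b\<in>?X. a < b}. m a b * r b)"
    using finX by (simp add: sum.Sigma[symmetric] distrib_left sum.distrib)
  also have "(\<Sum>a\<in>?X. \<Sum>b\<in>{b\<in>?X. a < b}. m a b * r b)
      = (\<Sum>b\<in>?X. \<Sum>a\<in>{a\<in>?X. a < b}. m a b * r b)"
    using finX by (rule sum.swap_restrict) (rule finX)
  also have "(\<Sum>a\<in>?X. \<Sum>b\<in>{b\<in>?X. a < b}. m a b * r a)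
      + (\<Sum>b\<in>?X. \<Sum>a\<in>{a\<in>?X. a < b}. m a b * r b) + (\<Sum>a\<in>?X. e a * r a)
      = (\<Sum>a\<in>?X. r a * ((\<Sum>b\<in>{b\<in>?X. a < b}. m a b) + e a))
      + (\<Sum>b\<in>?X. r b * (\<Sum>a\<in>{a\<in>?X. a < b}. m a b))"
    by (simp add: sum_distrib_left sum.distrib algebra_simps)
  also have "\<dots> \<le> (\<Sum>a\<in>?X. r a * real (card {\<sigma>\<in>K. h \<sigma> = a \<and> simplex_dim \<sigma> = p}))
      + (\<Sum>b\<in>?X. r b * real (card {\<sigma>\<in>K. h \<sigma> = b \<and> simplex_dim \<sigma> = Suc p}))"
  proof (intro add_mono sum_mono mult_left_mono r)
    fix a show "(\<Sum>b\<in>{b\<in>?X. a < b}. m a b) + e a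
        \<le> real (card {\<sigma>\<in>K. h \<sigma> = a \<and> simplex_dim \<sigma> = p})"
      using births_le[of a, where ?'k = 'k] unfolding m_def e_def
      by (simp only: of_nat_sum[symmetric] of_nat_add[symmetric] of_nat_le_iff)
    show "(\<Sum>b\<in>{b\<in>?X. b < a}. m b a)
        \<le> real (card {\<sigma>\<in>K. h \<sigma> = a \<and> simplex_dim \<sigma> = Suc p})"
      using deaths_le[of a, where ?'k = 'k] unfolding m_def
      by (simp only: of_nat_sum[symmetric] of_nat_le_iff)
  qed
  also have "\<dots> = (\<Sum>\<sigma> | \<sigma> \<in> K \<and> simplex_dim \<sigma> = p. r (h \<sigma>))
      + (\<Sum>\<sigma> | \<sigma> \<in> K \<and> simplex_dim \<sigma> = Suc p. r (h \<sigma>))"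
    by (simp only: sum_card_fibres)
  also have "\<dots> = (\<Sum>\<sigma>\<in>{\<sigma>\<in>K. simplex_dim \<sigma> = p} \<union> {\<sigma>\<in>K. simplex_dim \<sigma> = Suc p}. r (h \<sigma>))"
    using fin by (intro sum.union_disjoint[symmetric]) auto
  also have "{\<sigma>\<in>K. simplex_dim \<sigma> = p} \<union> {\<sigma>\<in>K. simplex_dim \<sigma> = Suc p}
      = {\<sigma>\<in>K. simplex_dim \<sigma> \<in> {p, p + 1}}" by auto
  finally show ?thesis .
qed

end

lemma dgm_coordinates:
  assumes "finite K" "q \<in># dgm k ceil p K h"
  shows "fst q \<in> h ` K" "snd q \<in> h ` K \<union> set_option ceil"
proof -
  have "finite {(a, b). a \<in> h ` K \<and> b \<in> h ` K \<and> a < b}"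
    by (rule finite_subset[of _ "h ` K \<times> h ` K"]) (use assms in auto)
  then show "fst q \<in> h ` K" "snd q \<in> h ` K \<union> set_option ceil"
    using assms unfolding dgm_def
    by (auto split: option.splits if_splits simp: in_replicate_mset set_mset_sum)
qed

section \<open>Vines between two consecutive crossing times\<close>

text \<open>Each of the four types allows at most two points on the diagonal, and a continuous
  function with finite range on a connected set is constant.\<close>

lemma vine_constant_if_on_diagonal:
  assumes "vine V" "I \<subseteq> {0..1}" "connected I" "\<And>t. t \<in> I \<Longrightarrow> V t \<in> diagonal"
  shows "\<exists>q. \<forall>t\<in>I. V t = q"
proof -
  have "finite (V ` {0..1} \<inter> diagonal)"
    using assms(1) unfolding vine_def vine_type1_def vine_type2_def vine_type3_def vine_type4_def
    by auto
  then have "finite (fst ` (V ` {0..1} \<inter> diagonal))" by simp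
  then have "finite ((\<lambda>t. fst (V t)) ` I)"
    by (rule finite_subset[rotated]) (use assms(2,4) in force)
  moreover have "continuous_on I (\<lambda>t. fst (V t))"
    using assms(1,2) unfolding vine_def by (auto intro: continuous_on_fst continuous_on_subset)
  ultimately have "(\<lambda>t. fst (V t)) constant_on I"
    using continuous_finite_range_constant[OF assms(3)] by blast
  then obtain c where "\<And>t. t \<in> I \<Longrightarrow> fst (V t) = c" unfolding constant_on_def by blast
  then have "\<forall>t\<in>I. V t = (c, c)" using assms(4) unfolding diagonal_def by fastforce
  then show ?thesis by blast
qed

text \<open>\<open>F\<close> is a set of functions, so simplices whose values agree at all times
  give a single element and do not count as crossing.\<close>

definition crossing_free :: "(real \<Rightarrow> real) set \<Rightarrow> real set \<Rightarrow> bool" where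
  "crossing_free F I \<longleftrightarrow> (\<forall>u\<in>F. \<forall>w\<in>F. \<forall>t\<in>I. u t = w t \<longrightarrow> u = w)"

definition on_tracks :: "(real \<Rightarrow> real) set \<Rightarrow> real \<times> real \<Rightarrow> real \<Rightarrow> bool" where
  "on_tracks F q t \<longleftrightarrow> q \<in> diagonal \<or> (\<exists>u\<in>F. \<exists>w\<in>F. q = (u t, w t))"

text \<open>
  The sets of times at which the curve follows one track, another track, or the diagonal are
  closed and pairwise disjoint.
\<close>

lemma stays_on_track:
  assumes F: "finite F" "\<And>u. u \<in> F \<Longrightarrow> continuous_on I u"
    and free: "crossing_free F I" and I: "connected I"
    and V: "continuous_on I V" "\<And>t. t \<in> I \<Longrightarrow> on_tracks F (V t) t"
    and uw: "u \<in> F" "w \<in> F" and s: "s \<in> I" "V s = (u s, w s)" "V s \<notin> diagonal"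
    and t: "t \<in> I"
  shows "V t = (u t, w t)"
proof -
  define P where "P = (\<lambda>(u, w). {t\<in>I. V t = (u t, w t)})"
  define A where "A = {t\<in>I. V t \<in> diagonal} \<union> \<Union> (P ` (F \<times> F - {(u, w)}))"
  have closedP: "closedin (top_of_set I) (P x)" if x: "x \<in> F \<times> F" for x
  proof -
    obtain a b where ab: "x = (a, b)" "a \<in> F" "b \<in> F" using x by auto
    have "continuous_on I (\<lambda>t. V t - (a t, b t))"
      using V(1) F(2) ab by (intro continuous_intros) auto
    then have "closedin (top_of_set I) {t\<in>I. V t - (a t, b t) = 0}"
      by (rule continuous_closedin_preimage_constant)
    then show ?thesis by (simp add: P_def ab)
  qed
  have "continuous_on I (\<lambda>t. fst (V t) - snd (V t))"
    using V(1) by (intro continuous_intros)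
  then have "closedin (top_of_set I) {t\<in>I. fst (V t) - snd (V t) = 0}"
    by (rule continuous_closedin_preimage_constant)
  moreover have "{t\<in>I. fst (V t) - snd (V t) = 0} = {t\<in>I. V t \<in> diagonal}"
    by (auto simp: diagonal_def prod_eq_iff)
  ultimately have "closedin (top_of_set I) A"
    unfolding A_def using F(1) closedP by (intro closedin_Un closedin_Union) auto
  moreover have "closedin (top_of_set I) (P (u, w))"
    using closedP uw by blast
  moreover have "I \<subseteq> P (u, w) \<union> A"
  proof
    fix t assume t: "t \<in> I"
    show "t \<in> P (u, w) \<union> A"
      using V(2)[OF t] t unfolding on_tracks_def A_def P_def by fastforce
  qed
  moreover have "P (u, w) \<inter> A = {}"
  proof -
    \<comment> \<open>Off the diagonal the two coordinates follow different functions, which cannot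
      meet on \<open>I\<close>; so this track avoids the diagonal throughout
      \<open>I\<close>.\<close>
    have "u \<noteq> w" using s(2,3) by (auto simp: diagonal_def)
    then have "u t \<noteq> w t" if "t \<in> I" for t
      using free uw that unfolding crossing_free_def by blast
    moreover have "u' = u \<and> w' = w" if "t \<in> I" "u' \<in> F" "w' \<in> F" "u t = u' t" "w t = w' t" for t u' w'
      using free uw that unfolding crossing_free_def by blast
    ultimately show ?thesis unfolding A_def P_def diagonal_def by (auto; metis)
  qed
  moreover have "P (u, w) \<noteq> {}" using s by (auto simp: P_def)
  ultimately have "A = {}"
    using I unfolding connected_closedin by blast
  then show ?thesis
    using t \<open>I \<subseteq> P (u, w) \<union> A\<close> by (auto simp: P_def)
qed

text \<open>
  The speed at time \<open>t\<close> of a function in \<open>F\<close> with value \<open>x\<close>.  All such functions coincide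
  if no functions in \<open>F\<close> cross at time \<open>t\<close>.
\<close>

definition speed :: "(real \<Rightarrow> real) set \<Rightarrow> real \<Rightarrow> real \<Rightarrow> real" where
  "speed F t x = (if \<exists>u\<in>F. u t = x then let u = SOME u. u \<in> F \<and> u t = x in \<bar>u 1 - u 0\<bar> else 0)"

lemma speed_nonneg: "speed F t x \<ge> 0"
  by (simp add: speed_def Let_def)

lemma speed_eq:
  assumes "crossing_free F I" "t \<in> I" "u \<in> F"
  shows "speed F t (u t) = \<bar>u 1 - u 0\<bar>"
proof -
  have "(SOME w. w \<in> F \<and> w t = u t) = u"
    using assms unfolding crossing_free_def by (intro some_equality) auto
  then show ?thesis using assms unfolding speed_def by auto
qed

text \<open>The sup-norm speed is the maximum of the two coordinate speeds. Their sum bounds it and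
  separates into a birth part and a death part.\<close>

definition vine_speed :: "(real \<Rightarrow> real) set \<Rightarrow> real \<Rightarrow> real \<times> real \<Rightarrow> real" where
  "vine_speed F t q = (if q \<in> diagonal then 0 else speed F t (fst q) + speed F t (snd q))"

text \<open>The position at the single time \<open>t0\<close> decides the behaviour on the whole
  interval: the vine either rests on the diagonal or follows one pair of affine functions.\<close>

lemma d_inf_le_vine_speed:
  assumes F: "finite F" "\<And>u. u \<in> F \<Longrightarrow> \<exists>\<alpha> \<beta>. u = (\<lambda>t. \<alpha> + \<beta> * t)"
    and free: "crossing_free F {a<..<b}" and ab: "0 \<le> a" "a < b" "b \<le> 1"
    and V: "vine V" "\<And>t. t \<in> {0..1} \<Longrightarrow> on_tracks F (V t) t"
    and st: "a \<le> s" "s \<le> t" "t \<le> b" and t0: "t0 \<in> {a<..<b}"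
  shows "d_inf (V s) (V t) \<le> vine_speed F t0 (V t0) * (t - s)"
proof -
  let ?I = "{a<..<b}"
  have sub: "?I \<subseteq> {0..1}" "{a..b} \<subseteq> {0..1}" using ab by auto
  have contV: "continuous_on {a..b} V" "continuous_on ?I V"
    using V(1) sub unfolding vine_def by (blast intro: continuous_on_subset)+
  have contF: "continuous_on X u" if "u \<in> F" for u X
    using F(2)[OF that] by (auto intro!: continuous_intros)
  \<comment> \<open>Tracks may cross at \<open>a\<close> and \<open>b\<close>, so equality is
    obtained on the open interval and passes to the end points by continuity.\<close>
  have extend: "\<forall>r\<in>{a..b}. V r = p r"
    if "continuous_on {a..b} p" "\<And>r. r \<in> ?I \<Longrightarrow> V r = p r" for p
  proof
    fix r assume r: "r \<in> {a..b}"
    have "continuous_on (closure ?I) (\<lambda>r. V r - p r)"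
      using contV that(1) ab by (auto intro!: continuous_intros)
    then have "V r - p r = 0"
      by (rule continuous_constant_on_closure) (use that(2) r ab in auto)
    then show "V r = p r" by simp
  qed
  have follow: "V r = (u r, w r)"
    if "s' \<in> ?I" "V s' = (u s', w s')" "V s' \<notin> diagonal" "u \<in> F" "w \<in> F" "r \<in> ?I" for s' u w r
    using stays_on_track[OF F(1) contF free _ contV(2) _ that(4,5,1,2,3,6)] V(2) sub by auto
  show ?thesis
  proof (cases "V t0 \<in> diagonal")
    case True
    \<comment> \<open>From an off-diagonal position the vine would follow its track up to
      \<open>t0\<close>, where two distinct functions would then meet.\<close>
    have "V r \<in> diagonal" if r: "r \<in> ?I" for r
    proof (rule ccontr)
      assume n: "V r \<notin> diagonal"
      then obtain u w where uw: "u \<in> F" "w \<in> F" "V r = (u r, w r)"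
        using V(2)[of r] sub r unfolding on_tracks_def by blast
      then have "u \<noteq> w" using n by (auto simp: diagonal_def)
      moreover have "V t0 = (u t0, w t0)" using follow[OF r uw(3) n uw(1,2) t0] .
      then have "u t0 = w t0" using True by (auto simp: diagonal_def)
      ultimately show False using free uw t0 unfolding crossing_free_def by blast
    qed
    then obtain q where "\<And>r. r \<in> ?I \<Longrightarrow> V r = q"
      using vine_constant_if_on_diagonal[OF V(1) sub(1)] by (metis connected_Ioo)
    then have "\<forall>r\<in>{a..b}. V r = q" by (intro extend) auto
    then have "V s = V t" using st by auto
    then show ?thesis using True by (simp add: vine_speed_def d_inf_def)
  next
    case False
    then obtain u w where uw: "u \<in> F" "w \<in> F" "V t0 = (u t0, w t0)"
      using V(2)[of t0] sub t0 unfolding on_tracks_def by blast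
    have "\<forall>r\<in>{a..b}. V r = (u r, w r)"
      using follow[OF t0 uw(3) False uw(1,2)] contF uw by (intro extend continuous_intros) auto
    then have Vst: "V s = (u s, w s)" "V t = (u t, w t)" using st by auto
    have lip: "\<bar>v s - v t\<bar> = \<bar>v 1 - v 0\<bar> * (t - s)" if v: "v \<in> F" for v
    proof -
      obtain \<alpha> \<beta> where "v = (\<lambda>t. \<alpha> + \<beta> * t)" using F(2)[OF v] by blast
      then have "v s - v t = (v 1 - v 0) * (s - t)" by (simp add: algebra_simps)
      then show ?thesis using st by (simp add: abs_mult)
    qed
    have "d_inf (V s) (V t) \<le> \<bar>u s - u t\<bar> + \<bar>w s - w t\<bar>"
      by (simp add: d_inf_def Vst)
    also have "\<dots> = vine_speed F t0 (V t0) * (t - s)"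
      using False uw speed_eq[OF free t0] by (simp add: vine_speed_def lip algebra_simps)
    finally show ?thesis .
  qed
qed

section \<open>Lengths of vines\<close>

lemma d_inf_nonneg: "0 \<le> d_inf p q"
  by (simp add: d_inf_def le_max_iff_disj)

text \<open>\<open>L\<close> acts as an upper bound for arc length: the sums over a subdivision
  telescope, and \<open>L\<close> is nondecreasing on the unit interval because distances are
  nonnegative.\<close>

lemma curve_length_le:
  assumes "\<And>s t. 0 \<le> s \<Longrightarrow> s \<le> t \<Longrightarrow> t \<le> 1 \<Longrightarrow> d_inf (V s) (V t) \<le> L t - L s"
  shows "curve_length V \<le> ennreal (L 1 - L 0)"
  unfolding curve_length_def
proof (intro SUP_least ennreal_leI)
  fix ts :: "real list" assume "ts \<in> {ts. sorted ts \<and> set ts \<subseteq> {0..1}}"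
  then have ts: "sorted ts" "set ts \<subseteq> {0..1}" by auto
  have mono: "L s \<le> L t" if "0 \<le> s" "s \<le> t" "t \<le> 1" for s t
    using order_trans[OF d_inf_nonneg assms[OF that]] by simp
  show "(\<Sum>i<length ts - 1. d_inf (V (ts ! i)) (V (ts ! Suc i))) \<le> L 1 - L 0"
  proof (cases "ts = []")
    case True
    then show ?thesis using mono[of 0 1] by simp
  next
    case False
    let ?n = "length ts - 1"
    have nth: "0 \<le> ts ! i" "ts ! i \<le> 1" if "i < length ts" for i
      using subsetD[OF ts(2) nth_mem[OF that]] by auto
    have "(\<Sum>i<?n. d_inf (V (ts ! i)) (V (ts ! Suc i))) \<le> (\<Sum>i<?n. L (ts ! Suc i) - L (ts ! i))"
      using ts(1) nth by (intro sum_mono assms) (auto intro: sorted_nth_mono)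
    also have "\<dots> = L (ts ! ?n) - L (ts ! 0)"
      by (rule sum_lessThan_telescope)
    also have "\<dots> \<le> L 1 - L 0"
      using nth[of ?n] nth[of 0] False mono[of "ts ! ?n" 1] mono[of 0 "ts ! 0"] by simp
    finally show ?thesis .
  qed
qed

text \<open>The constant \<open>L1 c - L2 c\<close> makes the two pieces agree at \<open>c\<close>;
  for \<open>s\<close> and \<open>t\<close> on different sides of \<open>c\<close> the triangle
  inequality is used.\<close>

lemma length_function_glue:
  fixes a c b :: real
  assumes c: "a \<le> c" "c \<le> b"
    and L1: "\<And>s t. a \<le> s \<Longrightarrow> s \<le> t \<Longrightarrow> t \<le> c \<Longrightarrow> d_inf (V s) (V t) \<le> L1 t - L1 s"
    and L2: "\<And>s t. c \<le> s \<Longrightarrow> s \<le> t \<Longrightarrow> t \<le> b \<Longrightarrow> d_inf (V s) (V t) \<le> L2 t - L2 s"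
    and L: "L = (\<lambda>t. if t \<le> c then L1 t else L1 c - L2 c + L2 t)"
    and st: "a \<le> s" "s \<le> t" "t \<le> b"
  shows "d_inf (V s) (V t) \<le> L t - L s"
proof -
  have tri: "d_inf (V s) (V t) \<le> d_inf (V s) (V c) + d_inf (V c) (V t)"
    unfolding d_inf_def by (auto simp: max_def)
  show ?thesis
    using tri st c L1[of s t] L1[of s c] L2[of s t] L2[of c t] by (auto simp: L)
qed

text \<open>The speed of a single vine may change from cell to cell; only the sum over all vines is
  bounded by \<open>S\<close> on every cell. The length functions are therefore built for all vines
  at once, by induction on the number of break points inside the interval.\<close>

lemma length_functions_exist:
  fixes B :: "real set"
  assumes B: "finite B"
    and cell: "\<And>a b. 0 \<le> a \<Longrightarrow> a < b \<Longrightarrow> b \<le> 1 \<Longrightarrow> B \<inter> {a<..<b} = {} \<Longrightarrow>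
      \<exists>c. (\<forall>V\<in>set Vs. \<forall>s t. a \<le> s \<and> s \<le> t \<and> t \<le> b \<longrightarrow> d_inf (V s) (V t) \<le> c V * (t - s))
        \<and> (\<Sum>V\<leftarrow>Vs. c V) \<le> S"
    and ab: "0 \<le> a" "a < b" "b \<le> 1"
  shows "\<exists>L. (\<forall>V\<in>set Vs. \<forall>s t. a \<le> s \<and> s \<le> t \<and> t \<le> b \<longrightarrow> d_inf (V s) (V t) \<le> L V t - L V s)
    \<and> (\<Sum>V\<leftarrow>Vs. L V b - L V a) \<le> S * (b - a)"
  using ab
proof (induction "card (B \<inter> {a<..<b})" arbitrary: a b rule: less_induct)
  case less
  show ?case
  proof (cases "B \<inter> {a<..<b} = {}")
    case True
    obtain c where c: "\<And>V s t. V \<in> set Vs \<Longrightarrow> a \<le> s \<Longrightarrow> s \<le> t \<Longrightarrow> t \<le> b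
        \<Longrightarrow> d_inf (V s) (V t) \<le> c V * (t - s)" "(\<Sum>V\<leftarrow>Vs. c V) \<le> S"
      using cell[OF less.prems True] by blast
    have "(\<Sum>V\<leftarrow>Vs. c V * b - c V * a) = (\<Sum>V\<leftarrow>Vs. c V) * (b - a)"
      by (simp add: right_diff_distrib sum_list_subtractf sum_list_mult_const)
    also have "\<dots> \<le> S * (b - a)"
      using c(2) less.prems by (intro mult_right_mono) auto
    finally show ?thesis
      using c(1) by (intro exI[of _ "\<lambda>V t. c V * t"]) (auto simp: right_diff_distrib)
  next
    case False
    \<comment> \<open>Any interior break point will do, since neither open half contains
      \<open>c\<close>.\<close>
    then obtain c where c: "c \<in> B" "a < c" "c < b" by auto
    have "B \<inter> {a<..<c} \<subset> B \<inter> {a<..<b}" "B \<inter> {c<..<b} \<subset> B \<inter> {a<..<b}"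
      using c by auto
    then have card: "card (B \<inter> {a<..<c}) < card (B \<inter> {a<..<b})"
      "card (B \<inter> {c<..<b}) < card (B \<inter> {a<..<b})"
      using B by (auto intro: psubset_card_mono)
    obtain L1 where L1: "\<And>V s t. V \<in> set Vs \<Longrightarrow> a \<le> s \<Longrightarrow> s \<le> t \<Longrightarrow> t \<le> c
        \<Longrightarrow> d_inf (V s) (V t) \<le> L1 V t - L1 V s" "(\<Sum>V\<leftarrow>Vs. L1 V c - L1 V a) \<le> S * (c - a)"
      using less.hyps[OF card(1)] less.prems c by force
    obtain L2 where L2: "\<And>V s t. V \<in> set Vs \<Longrightarrow> c \<le> s \<Longrightarrow> s \<le> t \<Longrightarrow> t \<le> b
        \<Longrightarrow> d_inf (V s) (V t) \<le> L2 V t - L2 V s" "(\<Sum>V\<leftarrow>Vs. L2 V b - L2 V c) \<le> S * (b - c)"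
      using less.hyps[OF card(2)] less.prems c by force
    define L where "L V = (\<lambda>t. if t \<le> c then L1 V t else L1 V c - L2 V c + L2 V t)" for V
    have "(\<Sum>V\<leftarrow>Vs. L V b - L V a) = (\<Sum>V\<leftarrow>Vs. L1 V c - L1 V a) + (\<Sum>V\<leftarrow>Vs. L2 V b - L2 V c)"
      using c unfolding sum_list_addf[symmetric] by (simp add: L_def algebra_simps)
    also have "\<dots> \<le> S * (b - a)"
      using L1(2) L2(2) by (simp add: algebra_simps)
    finally have "(\<Sum>V\<leftarrow>Vs. L V b - L V a) \<le> S * (b - a)" .
    moreover have "d_inf (V s) (V t) \<le> L V t - L V s"
      if "V \<in> set Vs" "a \<le> s" "s \<le> t" "t \<le> b" for V s t
      using length_function_glue[OF _ _ L1(1)[OF that(1)] L2(1)[OF that(1)] L_def that(2-4)] c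
      by simp
    ultimately show ?thesis by blast
  qed
qed

lemma sum_list_curve_length_le:
  assumes "\<And>V s t. V \<in> set Vs \<Longrightarrow> 0 \<le> s \<Longrightarrow> s \<le> t \<Longrightarrow> t \<le> 1 \<Longrightarrow> d_inf (V s) (V t) \<le> L V t - L V s"
  shows "(\<Sum>V\<leftarrow>Vs. curve_length V) \<le> ennreal (\<Sum>V\<leftarrow>Vs. L V 1 - L V 0)"
proof -
  \<comment> \<open>\<open>ennreal\<close> sends negative reals to 0, so it is additive only on
    nonnegative terms.\<close>
  have nonneg: "0 \<le> L V 1 - L V 0" if "V \<in> set Vs" for V
    using order_trans[OF d_inf_nonneg assms[OF that, of 0 1]] by simp
  have "(\<Sum>V\<leftarrow>Vs. curve_length V) \<le> (\<Sum>V\<leftarrow>Vs. ennreal (L V 1 - L V 0))"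
    using assms by (intro sum_list_mono curve_length_le) auto
  also have "\<dots> = ennreal (\<Sum>V\<leftarrow>Vs. L V 1 - L V 0)"
    using sum_list_ennreal[of "map (\<lambda>V. L V 1 - L V 0) Vs"] nonneg by (simp add: comp_def)
  finally show ?thesis .
qed

section \<open>The straight-line vineyard\<close>

text \<open>Two distinct affine functions agree at most once: a common value with equal slopes would
  make them equal.\<close>

lemma finite_crossing_times:
  assumes "finite F" "\<And>u. u \<in> F \<Longrightarrow> \<exists>\<alpha> \<beta> :: real. u = (\<lambda>t. \<alpha> + \<beta> * t)"
  shows "finite {t. \<exists>u\<in>F. \<exists>w\<in>F. u \<noteq> w \<and> u t = w t}"
proof -
  have "finite {t. u \<noteq> w \<and> u t = w t}" if uF: "u \<in> F" and wF: "w \<in> F" for u w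
  proof -
    obtain \<alpha> \<beta> where u: "u = (\<lambda>t. \<alpha> + \<beta> * t)" using assms(2)[OF uF] by blast
    obtain \<alpha>' \<beta>' where w: "w = (\<lambda>t. \<alpha>' + \<beta>' * t)" using assms(2)[OF wF] by blast
    have "{t. u \<noteq> w \<and> u t = w t} \<subseteq> {(\<alpha>' - \<alpha>) / (\<beta> - \<beta>')}"
    proof (intro subsetI, clarsimp)
      fix t assume ne: "u \<noteq> w" and eq: "u t = w t"
      have "\<beta> \<noteq> \<beta>'" using ne eq unfolding u w by auto
      then show "t = (\<alpha>' - \<alpha>) / (\<beta> - \<beta>')" using eq unfolding u w by (simp add: field_simps)
    qed
    then show ?thesis by (rule finite_subset) simp
  qed
  then have "finite (\<Union>u\<in>F. \<Union>w\<in>F. {t. u \<noteq> w \<and> u t = w t})"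
    using assms(1) by blast
  then show ?thesis by (rule finite_subset[rotated]) blast
qed

theorem theorem6:
  fixes K :: "'v::linorder set set"
    and f g :: "'v set \<Rightarrow> real"
    and d :: nat
    and ceil :: "real option"
  assumes "simplicial_complex K"
    and "mono_on K f"
    and "mono_on K g"
    and "\<forall>C\<in>set_option ceil. \<forall>\<sigma>\<in>K. f \<sigma> \<le> C \<and> g \<sigma> \<le> C"
    and "decomposable_vineyard (straight_line_vineyard TYPE('k::field) ceil d K f g)"
  shows "vineyard_distance (straight_line_vineyard TYPE('k) ceil d K f g)
      \<le> ennreal (\<Sum>\<sigma> | \<sigma> \<in> K \<and> simplex_dim \<sigma> \<in> {d, d + 1}. \<bar>f \<sigma> - g \<sigma>\<bar>)"
  unfolding vineyard_distance_def
proof (rule SUP_least)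
  let ?D = "straight_line_vineyard TYPE('k) ceil d K f g"
  let ?S = "\<Sum>\<sigma> | \<sigma> \<in> K \<and> simplex_dim \<sigma> \<in> {d, d + 1}. \<bar>f \<sigma> - g \<sigma>\<bar>"
  \<comment> \<open>The distance is a supremum over decompositions, so each decomposition is bounded
    separately.\<close>
  fix Vs assume "Vs \<in> {Vs. vine_decomposition ?D Vs}"
  then have vines: "\<And>V. V \<in> set Vs \<Longrightarrow> vine V"
    and D: "\<And>t. t \<in> {0..1} \<Longrightarrow> off_diagonal (mset (map (\<lambda>V. V t) Vs)) = off_diagonal (?D t)"
    unfolding vine_decomposition_def by auto
  have fin: "finite K" using assms(1) by (simp add: simplicial_complex_def)
  define h where "h \<sigma> = (\<lambda>t. (1 - t) * f \<sigma> + t * g \<sigma>)" for \<sigma>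
  \<comment> \<open>The ceiling joins as a constant function, so that points of essential classes
    lie on tracks too.\<close>
  define F where "F = h ` K \<union> (\<lambda>C t. C) ` set_option ceil"
  define B where "B = {t. \<exists>u\<in>F. \<exists>w\<in>F. u \<noteq> w \<and> u t = w t}"
  have Dt: "?D t = dgm TYPE('k) ceil d K (\<lambda>\<sigma>. h \<sigma> t)" for t
    by (simp add: straight_line_vineyard_def h_def)
  have finF: "finite F" using fin by (simp add: F_def)
  have affine: "\<exists>\<alpha> \<beta>. u = (\<lambda>t. \<alpha> + \<beta> * t)" if u: "u \<in> F" for u
    using u unfolding F_def
  proof
    assume "u \<in> h ` K"
    then obtain \<sigma> where "u = h \<sigma>" by blast
    then have "u = (\<lambda>t. f \<sigma> + (g \<sigma> - f \<sigma>) * t)" by (auto simp: h_def algebra_simps)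
    then show ?thesis by blast
  next
    assume "u \<in> (\<lambda>C t. C) ` set_option ceil"
    then obtain C where "u = (\<lambda>t. C + 0 * t)" by auto
    then show ?thesis by blast
  qed
  have tracks: "on_tracks F (V t) t" if V: "V \<in> set Vs" and t: "t \<in> {0..1}" for V t
  proof (cases "V t \<in> diagonal")
    case False
    then have "V t \<in># off_diagonal (mset (map (\<lambda>V. V t) Vs))"
      using V by (auto simp: off_diagonal_def)
    then have "V t \<in># ?D t" unfolding D[OF t] by (simp add: off_diagonal_def)
    moreover have "(\<lambda>u. u t) ` F = (\<lambda>\<sigma>. h \<sigma> t) ` K \<union> set_option ceil"
      by (simp add: F_def image_Un image_image)
    ultimately have "fst (V t) \<in> (\<lambda>u. u t) ` F" "snd (V t) \<in> (\<lambda>u. u t) ` F"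
      using dgm_coordinates[OF fin, of "V t" "TYPE('k)" ceil d "\<lambda>\<sigma>. h \<sigma> t"]
      unfolding Dt by auto
    then obtain u w where "u \<in> F" "w \<in> F" "V t = (u t, w t)"
      by (auto simp: prod_eq_iff)
    then show ?thesis unfolding on_tracks_def by blast
  qed (simp add: on_tracks_def)
  have cell: "\<exists>c. (\<forall>V\<in>set Vs. \<forall>s t. a \<le> s \<and> s \<le> t \<and> t \<le> b \<longrightarrow> d_inf (V s) (V t) \<le> c V * (t - s))
        \<and> (\<Sum>V\<leftarrow>Vs. c V) \<le> ?S"
    if ab: "0 \<le> a" "a < b" "b \<le> 1" and "B \<inter> {a<..<b} = {}" for a b
  proof -
    have free: "crossing_free F {a<..<b}"
      using that(4) unfolding crossing_free_def B_def by blast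
    \<comment> \<open>Any interior time serves, because tracks do not change partners within the
      cell.\<close>
    obtain t0 where t0: "t0 \<in> {a<..<b}" using dense[OF ab(2)] by auto
    then have t01: "t0 \<in> {0..1}" using ab by auto
    define c where "c q = speed F t0 (fst q) + speed F t0 (snd q)" for q
    have c_nonneg: "c q \<ge> 0" for q by (simp add: c_def speed_nonneg)
    have "(\<Sum>V\<leftarrow>Vs. vine_speed F t0 (V t0)) = (\<Sum>q\<in>#off_diagonal (mset (map (\<lambda>V. V t0) Vs)). c q)"
      by (induction Vs) (auto simp: off_diagonal_def vine_speed_def c_def)
    also have "\<dots> = (\<Sum>q\<in>#off_diagonal (?D t0). c q)" by (simp only: D[OF t01])
    also have "\<dots> \<le> (\<Sum>q\<in>#?D t0. c q)"
    proof -
      have "(\<Sum>q\<in>#off_diagonal P. c q) \<le> (\<Sum>q\<in>#P. c q)" for P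
        using c_nonneg by (induction P) (auto simp: off_diagonal_def intro: add_increasing)
      then show ?thesis .
    qed
    also have "\<dots> \<le> (\<Sum>\<sigma> | \<sigma> \<in> K \<and> simplex_dim \<sigma> \<in> {d, d + 1}. speed F t0 (h \<sigma> t0))"
    proof -
      \<comment> \<open>Without crossings at \<open>t0\<close>, every track with value
        \<open>C\<close> there is the constant function of the ceiling.\<close>
      have "speed F t0 C = 0" if "ceil = Some C" for C
        using speed_eq[OF free t0, of "\<lambda>t. C"] that by (simp add: F_def)
      then show ?thesis
        using sum_dgm_le[OF fin, of "speed F t0" ceil d "\<lambda>\<sigma>. h \<sigma> t0", where ?'k = 'k] speed_nonneg
        unfolding Dt c_def by (simp add: split_def)
    qed
    \<comment> \<open>Tracks sharing a value at \<open>t0\<close> coincide, so the speed attached to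
      the value of \<open>h \<sigma>\<close> is the absolute slope of \<open>h \<sigma>\<close>
      itself.\<close>
    also have "\<dots> = ?S"
    proof (intro sum.cong refl)
      fix \<sigma> assume "\<sigma> \<in> {\<sigma> \<in> K. simplex_dim \<sigma> \<in> {d, d + 1}}"
      then have "speed F t0 (h \<sigma> t0) = \<bar>h \<sigma> 1 - h \<sigma> 0\<bar>"
        by (intro speed_eq[OF free t0]) (simp add: F_def)
      then show "speed F t0 (h \<sigma> t0) = \<bar>f \<sigma> - g \<sigma>\<bar>"
        by (simp add: h_def abs_minus_commute)
    qed
    finally have "(\<Sum>V\<leftarrow>Vs. vine_speed F t0 (V t0)) \<le> ?S" .
    moreover have "d_inf (V s) (V t) \<le> vine_speed F t0 (V t0) * (t - s)"
      if "V \<in> set Vs" "a \<le> s" "s \<le> t" "t \<le> b" for V s t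
      by (rule d_inf_le_vine_speed[OF finF affine free ab vines[OF that(1)] tracks[OF that(1)]
            that(2-4) t0])
    ultimately show ?thesis
      by (intro exI[of _ "\<lambda>V. vine_speed F t0 (V t0)"]) blast
  qed
  have "finite B" unfolding B_def by (rule finite_crossing_times[OF finF affine])
  then have "\<exists>L. (\<forall>V\<in>set Vs. \<forall>s t. 0 \<le> s \<and> s \<le> t \<and> t \<le> 1 \<longrightarrow> d_inf (V s) (V t) \<le> L V t - L V s)
      \<and> (\<Sum>V\<leftarrow>Vs. L V 1 - L V 0) \<le> ?S * (1 - 0)"
    by (rule length_functions_exist[OF _ cell]) auto
  then obtain L where L: "\<And>V s t. V \<in> set Vs \<Longrightarrow> 0 \<le> s \<Longrightarrow> s \<le> t \<Longrightarrow> t \<le> 1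
      \<Longrightarrow> d_inf (V s) (V t) \<le> L V t - L V s" "(\<Sum>V\<leftarrow>Vs. L V 1 - L V 0) \<le> ?S"
    unfolding diff_zero mult_1_right by blast
  show "(\<Sum>V\<leftarrow>Vs. curve_length V) \<le> ennreal ?S"
    using sum_list_curve_length_le[OF L(1)] ennreal_leI[OF L(2)] by (rule order_trans)
qed

end
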